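(* Let $T>0$, $\mu>0$, $f\in L^2(0,T)$, $p\ge2$, and let the discrete spaces $S_h^p(0,T)\subset H^2_{0,\bullet}(0,T)$ satisfy Assumption A (stated in the context). Let $u\in H^2_{0,\bullet}(0,T)$ be the unique solution of $$a_\mu(u,w)=(f,\partial_tw)_{L^2(0,T)}\quad\text{for all }w\in H^2_{0,\bullet}(0,T),$$ and let $u_h\in S_h^p(0,T)$ be the unique solution of $$a_\mu(u_h,\mathcal{L}_Tw_h)=(f,\partial_t\mathcal{L}_Tw_h)_{L^2(0,T)}\quad\text{for all }w_h\in S_h^p(0,T).$$ If $u\in H^2_{0,\bullet}(0,T)\cap H^{s+1}(0,T)$ for an integer $s$ with $1\le s\le p$, then $$\|u-u_h\|_{L^2(0,T)}\le C_\mu\,h^{s}\,\|\partial_t^{s+1}u\|_{L^2(0,T)},$$ where $C_\mu$ is a positive constant depending on $p,T,\mu$ but independent of $h$.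
   Context: $H^2_{0,\bullet}(0,T):=\{u\in H^2(0,T): u(0)=0\}$, with norm $\|u\|_{H^2_{0,\bullet}(0,T)}:=\|\partial_t^2u\|_{L^2(0,T)}+\frac1T\|\partial_tu\|_{L^2(0,T)}$; $$a_\mu(u,w):=(\partial_t^2u,\partial_t w)_{L^2(0,T)}+\partial_tu(0)\,\partial_tw(0)+\mu\,(u,\partial_tw)_{L^2(0,T)};\qquad \mathcal{L}_Tw(t):=\int_0^te^{-s/T}\partial_sw(s)\,\mathrm{d}s .$$ $\{S_h^p(0,T)\}_h$ is a family of finite dimensional subspaces of $H^2_{0,\bullet}(0,T)$, depending on a mesh parameter $h>0$, for a fixed polynomial degree $p$. Assumption A: (i) there is a constant $C_I>0$, depending on $p$ but not on $h$, such that for all $w_h\in S_h^p(0,T)$: $\|w_h\|_{H^2_{0,\bullet}(0,T)}\le C_Ih^{-1}\|\partial_tw_h\|_{L^2(0,T)}$ and $\|\partial_tw_h\|_{L^2(0,T)}\le C_Ih^{-1}\|w_h\|_{L^2(0,T)}$. (ii) There is a constant $C_a>0$, depending on $p$ but not on $h$, such that for each integer $0\le s\le p$ and each $w\in H^2_{0,\bullet}(0,T)\cap H^{s+1}(0,T)$ there is a function $\widetilde w_h\in S_h^p(0,T)$ with $\|\partial_t^\ell w-\partial_t^\ell\widetilde w_h\|_{L^2(0,T)}\le C_ah^{s+1-\ell}\|\partial_t^{s+1}w\|_{L^2(0,T)}$ for all $\ell\in\{0,1,2\}$ with $\ell\le s$, and, if in addition $w\in W^{s+1}_\infty(0,T)$,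 also $\|\partial_tw-\partial_t\widetilde w_h\|_{L^\infty(0,T)}\le C_ah^s\|\partial_t^{s+1}w\|_{L^\infty(0,T)}$. Since $C_I,C_a$ count as depending on $p$, the constant $C_\mu$ may depend on them. *)

theory Defs
  imports "HOL-Analysis.Analysis" "HOL-Probability.Essential_Supremum"
begin

text \<open>
  Elements of Lebesgue and Sobolev spaces on \<open>(0,T)\<close> are represented by functions
  \<open>real \<Rightarrow> real\<close>. The norms, derivatives, point values and forms below depend only on
  the almost-everywhere classes of their arguments on \<open>(0,T)\<close>, and values outside \<open>(0,T)\<close> are
  irrelevant.
\<close>

abbreviation leb :: "real \<Rightarrow> real measure" where
  "leb T \<equiv> lebesgue_on {0<..<T}"

definition L2 :: "real \<Rightarrow> (real \<Rightarrow> real) set" where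
  "L2 T = {f \<in> borel_measurable (leb T). integrable (leb T) (\<lambda>t. (f t)\<^sup>2)}"

definition L2_inner :: "real \<Rightarrow> (real \<Rightarrow> real) \<Rightarrow> (real \<Rightarrow> real) \<Rightarrow> real" where
  "L2_inner T f g = (LINT t|leb T. f t * g t)"

definition L2_norm :: "real \<Rightarrow> (real \<Rightarrow> real) \<Rightarrow> real" where
  "L2_norm T f = sqrt (LINT t|leb T. (f t)\<^sup>2)"

definition Linf_norm :: "real \<Rightarrow> (real \<Rightarrow> real) \<Rightarrow> ereal" where
  "Linf_norm T f = esssup (leb T) (\<lambda>t. ereal \<bar>f t\<bar>)"

definition Linf :: "real \<Rightarrow> (real \<Rightarrow> real) set" where
  "Linf T = {f \<in> borel_measurable (leb T). Linf_norm T f < \<infinity>}"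

definition L1_loc :: "real \<Rightarrow> (real \<Rightarrow> real) set" where
  "L1_loc T = {f. \<forall>a b. 0 < a \<longrightarrow> b < T \<longrightarrow> set_integrable lebesgue {a..b} f}"

text \<open>The test functions \<open>C\<^sub>c\<^sup>\<infinity>(0,T)\<close>, extended by zero to the real line.\<close>

definition test_functions :: "real \<Rightarrow> (real \<Rightarrow> real) set" where
  "test_functions T = {\<phi>. (\<forall>k x. (deriv ^^ k) \<phi> differentiable (at x)) \<and>
     (\<exists>a b. 0 < a \<and> b < T \<and> (\<forall>x. x \<notin> {a..b} \<longrightarrow> \<phi> x = 0))}"

definition weak_deriv :: "real \<Rightarrow> nat \<Rightarrow> (real \<Rightarrow> real) \<Rightarrow> (real \<Rightarrow> real) \<Rightarrow> bool" where
  "weak_deriv T k u v \<longleftrightarrow> u \<in> L1_loc T \<and> v \<in> L1_loc T \<and>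
     (\<forall>\<phi>\<in>test_functions T.
        (LINT t|leb T. u t * (deriv ^^ k) \<phi> t) = (-1) ^ k * (LINT t|leb T. v t * \<phi> t))"

text \<open>
  \<open>wD T k u\<close> is a representative of the weak derivative \<open>\<partial>\<^sub>t\<^sup>k u\<close>; weak derivatives are unique only
  up to null sets, hence the choice operator.
\<close>

definition wD :: "real \<Rightarrow> nat \<Rightarrow> (real \<Rightarrow> real) \<Rightarrow> (real \<Rightarrow> real)" where
  "wD T k u = (SOME v. weak_deriv T k u v)"

definition H_space :: "real \<Rightarrow> nat \<Rightarrow> (real \<Rightarrow> real) set" where
  "H_space T k = {u \<in> L2 T. \<forall>j\<le>k. \<exists>v\<in>L2 T. weak_deriv T j u v}"

definition W_inf_space :: "real \<Rightarrow> nat \<Rightarrow> (real \<Rightarrow> real) set" where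
  "W_inf_space T k = {u \<in> Linf T. \<forall>j\<le>k. \<exists>v\<in>Linf T. weak_deriv T j u v}"

text \<open>
  The point value \<open>u(t)\<close>, \<open>t \<in> [0,T]\<close>, of a class \<open>u\<close> is that of its continuous representative
  on \<open>[0,T]\<close>, which exists for \<open>u \<in> H\<^sup>1(0,T)\<close>.
\<close>

definition point_val :: "real \<Rightarrow> (real \<Rightarrow> real) \<Rightarrow> real \<Rightarrow> real" where
  "point_val T u t =
     (THE c. \<exists>g. continuous_on {0..T} g \<and> (AE s in leb T. u s = g s) \<and> g t = c)"

definition H20 :: "real \<Rightarrow> (real \<Rightarrow> real) set" where
  "H20 T = {u \<in> H_space T 2. point_val T u 0 = 0}"

definition H20_norm :: "real \<Rightarrow> (real \<Rightarrow> real) \<Rightarrow> real" where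
  "H20_norm T u = L2_norm T (wD T 2 u) + 1 / T * L2_norm T (wD T 1 u)"

definition a_form :: "real \<Rightarrow> real \<Rightarrow> (real \<Rightarrow> real) \<Rightarrow> (real \<Rightarrow> real) \<Rightarrow> real" where
  "a_form T \<mu> u w = L2_inner T (wD T 2 u) (wD T 1 w)
     + point_val T (wD T 1 u) 0 * point_val T (wD T 1 w) 0
     + \<mu> * L2_inner T u (wD T 1 w)"

definition L_op :: "real \<Rightarrow> (real \<Rightarrow> real) \<Rightarrow> (real \<Rightarrow> real)" where
  "L_op T w = (\<lambda>t. LINT s:{0..t}|lebesgue. exp (- s / T) * wD T 1 w s)"

text \<open>Finite dimensionality is meant modulo almost-everywhere equality.\<close>

definition finite_dim_subspace :: "real \<Rightarrow> (real \<Rightarrow> real) set \<Rightarrow> bool" where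
  "finite_dim_subspace T V \<longleftrightarrow> V \<subseteq> H20 T \<and> (\<lambda>t. 0) \<in> V \<and>
     (\<forall>v\<in>V. \<forall>w\<in>V. (\<lambda>t. v t + w t) \<in> V) \<and>
     (\<forall>c. \<forall>v\<in>V. (\<lambda>t. c * v t) \<in> V) \<and>
     (\<exists>B. finite B \<and> B \<subseteq> V \<and>
        (\<forall>v\<in>V. \<exists>c. AE t in leb T. v t = (\<Sum>b\<in>B. c b * b t)))"

text \<open>\<open>\<H>\<close> is the set of mesh parameters for which the family \<open>S\<close> is given.\<close>

definition discrete_spaces :: "real \<Rightarrow> real set \<Rightarrow> (real \<Rightarrow> (real \<Rightarrow> real) set) \<Rightarrow> bool" where
  "discrete_spaces T \<H> S \<longleftrightarrow> (\<forall>h\<in>\<H>. 0 < h \<and> finite_dim_subspace T (S h))"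

definition inverse_inequalities ::
    "real \<Rightarrow> real \<Rightarrow> real set \<Rightarrow> (real \<Rightarrow> (real \<Rightarrow> real) set) \<Rightarrow> bool" where
  "inverse_inequalities T C\<^sub>I \<H> S \<longleftrightarrow> (\<forall>h\<in>\<H>. \<forall>w\<in>S h.
     H20_norm T w \<le> C\<^sub>I * inverse h * L2_norm T (wD T 1 w) \<and>
     L2_norm T (wD T 1 w) \<le> C\<^sub>I * inverse h * L2_norm T w)"

definition approximation_property ::
    "real \<Rightarrow> nat \<Rightarrow> real \<Rightarrow> real set \<Rightarrow> (real \<Rightarrow> (real \<Rightarrow> real) set) \<Rightarrow> bool" where
  "approximation_property T p C\<^sub>a \<H> S \<longleftrightarrow>
     (\<forall>h\<in>\<H>. \<forall>s\<le>p. \<forall>w \<in> H20 T \<inter> H_space T (s + 1). \<exists>w'\<in>S h.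
        (\<forall>l\<in>{0,1,2}. l \<le> s \<longrightarrow>
           L2_norm T (\<lambda>t. wD T l w t - wD T l w' t)
             \<le> C\<^sub>a * h ^ (s + 1 - l) * L2_norm T (wD T (s + 1) w)) \<and>
        (w \<in> W_inf_space T (s + 1) \<longrightarrow>
           Linf_norm T (\<lambda>t. wD T 1 w t - wD T 1 w' t)
             \<le> ereal (C\<^sub>a * h ^ s) * Linf_norm T (wD T (s + 1) w)))"

definition assumption_A ::
    "real \<Rightarrow> nat \<Rightarrow> real \<Rightarrow> real \<Rightarrow> real set \<Rightarrow> (real \<Rightarrow> (real \<Rightarrow> real) set) \<Rightarrow> bool" where
  "assumption_A T p C\<^sub>I C\<^sub>a \<H> S \<longleftrightarrow>
     inverse_inequalities T C\<^sub>I \<H> S \<and> approximation_property T p C\<^sub>a \<H> S"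

definition continuous_solution ::
    "real \<Rightarrow> real \<Rightarrow> (real \<Rightarrow> real) \<Rightarrow> (real \<Rightarrow> real) \<Rightarrow> bool" where
  "continuous_solution T \<mu> f u \<longleftrightarrow> u \<in> H20 T \<and>
     (\<forall>w\<in>H20 T. a_form T \<mu> u w = L2_inner T f (wD T 1 w))"

definition discrete_solution ::
    "real \<Rightarrow> real \<Rightarrow> (real \<Rightarrow> real) \<Rightarrow> (real \<Rightarrow> real) set \<Rightarrow> (real \<Rightarrow> real) \<Rightarrow> bool" where
  "discrete_solution T \<mu> f V u\<^sub>h \<longleftrightarrow> u\<^sub>h \<in> V \<and>
     (\<forall>w\<in>V. a_form T \<mu> u\<^sub>h (L_op T w) = L2_inner T f (wD T 1 (L_op T w)))"

end

theory Submission
  imports Defs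
begin

text \<open>
  Write \<open>e = u - u\<^sub>h\<close>, \<open>\<rho>(t) = exp(- t / T)\<close> and \<open>B(v,w) = a\<^sub>\<mu>(v, \<L>\<^sub>T w) = (v'', \<rho> w') + v'(0) w'(0) + \<mu> (v, \<rho> w')\<close>.
  Integration by parts against the decreasing weight makes \<open>B\<close> coercive in
  \<open>\<parallel>w'\<parallel>\<^sup>2 + w'(0)\<^sup>2\<close>. Comparing \<open>u\<^sub>h\<close> with an interpolant \<open>w\<close> of \<open>u\<close> by Galerkin orthogonality,
  and then using the inverse inequality for \<open>w - u\<^sub>h\<close>, gives \<open>\<parallel>e'\<parallel>\<close>, \<open>\<bar>e'(0)\<bar>\<close> and \<open>h \<parallel>e''\<parallel>\<close> of order
  \<open>h\<^sup>s\<^sup>-\<^sup>1\<close>.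

  One more order in \<open>L\<^sup>2\<close> comes from duality. The solution of \<open>\<zeta>'' + \<mu> \<zeta> = e\<close>,
  \<open>\<zeta>(T) = \<zeta>'(T) = 0\<close> satisfies \<open>B(v, Z) = (v, e)\<close> for \<open>Z' = \<zeta> / \<rho>\<close>, and \<open>Z \<in> H\<^sup>3\<close>, so that
  \<open>\<parallel>e\<parallel>\<^sup>2 = B(e, Z - Z\<^sub>h)\<close> with \<open>\<parallel>(Z - Z\<^sub>h)'\<parallel> = O(h\<^sup>2) \<parallel>e\<parallel>\<close> and \<open>(Z - Z\<^sub>h)'(0) = O(h) \<parallel>e\<parallel>\<close>.
  This is where \<open>p \<ge> 2\<close> is needed.
\<close>

section \<open>Indefinite integrals\<close>

text \<open>The form pairs a second derivative with a first one, so the energy step can only inherit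
  the interpolation order of the second derivative. Duality makes up for this:
  \<open>(e'', \<rho> (Z - Z_h)')\<close> is of order h^(s-2) h^2, the product of the initial slopes
  of order h^(s-1) h, and the zero-order term is smaller still. For s = 1 the approximation property
  says nothing about second derivatives; there a multiple of the function t replaces the
  interpolant, and t belongs to every discrete space. The inverse inequality for t also yields
  \<open>h \<le> C\<^sub>I * T\<close>, which absorbs surplus powers of h for all mesh parameters at
  once. A further obstacle is that the definitions speak of classes, with weak derivatives picked by
  choice. Each trial function is therefore replaced by absolutely continuous representatives.
  Absolute continuity is encoded as being an indefinite integral, so that the product rule, and with
  it integration by parts, comes from Fubini's theorem instead of a theory of differentiation almost
  everywhere.\<close>

interpretation leb: finite_measure "leb T" for T :: real
  by (rule finite_measure_lebesgue_on) simp

lemma borel_measurable_leb [measurable (raw)]: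
  fixes f :: "real \<Rightarrow> real"
  shows "f \<in> borel_measurable borel \<Longrightarrow> f \<in> borel_measurable (leb T)"
  by (intro measurable_restrict_space1 measurable_completion) simp

section \<open>Almost-everywhere equality on the interval\<close>

lemma AE_leb_iff: "(AE t in leb T. P t) \<longleftrightarrow> (AE t in lebesgue. t \<in> {0<..<T} \<longrightarrow> P t)"
  by (simp add: AE_restrict_space_iff)

lemma AE_leb_I: "(\<And>t. 0 < t \<Longrightarrow> t < T \<Longrightarrow> P t) \<Longrightarrow> AE t in leb T. P t"
  by (intro AE_I2) auto

lemma AE_leb_neq: "AE t in leb T. t \<noteq> c"
proof -
  have "{c} \<in> null_sets lebesgue"
    using null_sets_completionI by fastforce
  from AE_not_in[OF this] show ?thesis
    unfolding AE_leb_iff by eventually_elim auto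
qed

text \<open>Rests on the completeness of Lebesgue measure, carried over to the interval by extension
  by zero.\<close>

lemma borel_measurable_leb_AE:
  fixes f g :: "real \<Rightarrow> real"
  assumes f: "f \<in> borel_measurable (leb T)" and ae: "AE t in leb T. f t = g t"
  shows "g \<in> borel_measurable (leb T)"
proof -
  let ?r = "\<lambda>f x. if x \<in> {0<..<T} then f x else (0::real)"
  have "?r f \<in> borel_measurable lebesgue"
    using f by (intro borel_measurable_if_I) auto
  moreover have "AE t in lebesgue. ?r f t = ?r g t"
    using ae unfolding AE_leb_iff by eventually_elim auto
  ultimately have "?r g \<in> borel_measurable lebesgue"
    by (rule borel_measurable_AE)
  then show ?thesis by (rule borel_measurable_if_D)
qed

lemma integrable_leb_AE:
  fixes f g :: "real \<Rightarrow> real"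
  assumes "integrable (leb T) f" "AE t in leb T. f t = g t"
  shows "integrable (leb T) g"
  using assms borel_measurable_leb_AE[of f T g] by (metis integrable_cong_AE_imp borel_measurable_integrable AE_symmetric)

text \<open>By completeness \<open>f\<close> and \<open>g\<close> are measurable together. If
  neither is, neither is integrable, and both integrals have the default value 0.\<close>

lemma integral_leb_AE:
  fixes f g :: "real \<Rightarrow> real"
  assumes "AE t in leb T. f t = g t"
  shows "integral\<^sup>L (leb T) f = integral\<^sup>L (leb T) g"
proof (cases "f \<in> borel_measurable (leb T)")
  case True
  then show ?thesis using assms borel_measurable_leb_AE[OF True assms] by (intro integral_cong_AE)
next
  case False
  have "AE t in leb T. g t = f t" using assms by eventually_elim simp
  then have "g \<notin> borel_measurable (leb T)" using False borel_measurable_leb_AE by blast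
  with False show ?thesis
    by (metis borel_measurable_integrable not_integrable_integral_eq)
qed

text \<open>The indicator of the half-line \<open>{..t}\<close> makes the indefinite integral a
  function on the whole real line, constant outside \<open>[0, T]\<close>, so that continuity and
  Borel measurability hold globally.\<close>

definition prim :: "real \<Rightarrow> (real \<Rightarrow> real) \<Rightarrow> real \<Rightarrow> real" where
  "prim T g t = (LINT s|leb T. indicator {..t} s * g s)"

lemma integrable_leb_bounded_mult:
  fixes f g :: "real \<Rightarrow> real"
  assumes g: "integrable (leb T) g" and [measurable]: "f \<in> borel_measurable (leb T)"
    and b: "\<And>t. 0 < t \<Longrightarrow> t < T \<Longrightarrow> \<bar>f t\<bar> \<le> B"
  shows "integrable (leb T) (\<lambda>t. f t * g t)"
proof (rule Bochner_Integration.integrable_bound)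
  show "integrable (leb T) (\<lambda>t. B * g t)" using g by simp
  show "(\<lambda>t. f t * g t) \<in> borel_measurable (leb T)" using g by measurable
  show "AE t in leb T. norm (f t * g t) \<le> norm (B * g t)"
    using b by (intro AE_leb_I) (auto simp: abs_mult intro!: mult_right_mono dest: order_trans[OF _ abs_ge_self])
qed

lemma integrable_indicator_atMost:
  fixes g :: "real \<Rightarrow> real"
  shows "integrable (leb T) g \<Longrightarrow> integrable (leb T) (\<lambda>s. indicator {..t} s * g s)"
  by (rule integrable_leb_bounded_mult[where B=1]) (auto simp: indicator_def)

lemma prim_0: "t \<le> 0 \<Longrightarrow> prim T g t = 0"
  unfolding prim_def by (intro integral_eq_zero_AE AE_leb_I) (auto simp: indicator_def)

lemma prim_T: "T \<le> t \<Longrightarrow> prim T g t = (LINT s|leb T. g s)"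
  unfolding prim_def by (intro Bochner_Integration.integral_cong) (auto simp: indicator_def)

lemma prim_add:
  assumes "integrable (leb T) f" "integrable (leb T) g"
  shows "prim T (\<lambda>s. f s + g s) t = prim T f t + prim T g t"
  unfolding prim_def
  by (simp add: distrib_left integrable_indicator_atMost assms)

lemma prim_diff:
  assumes "integrable (leb T) f" "integrable (leb T) g"
  shows "prim T (\<lambda>s. f s - g s) t = prim T f t - prim T g t"
  unfolding prim_def
  by (simp add: right_diff_distrib integrable_indicator_atMost assms)

lemma prim_cmult: "prim T (\<lambda>s. c * g s) t = c * prim T g t"
  unfolding prim_def by (simp add: mult.left_commute)

lemma prim_cong_AE:
  assumes "AE s in leb T. f s = g s"
  shows "prim T f t = prim T g t"
  unfolding prim_def by (rule integral_leb_AE) (use assms in eventually_elim, simp)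

lemma continuous_on_prim:
  assumes g: "integrable (leb T) g"
  shows "continuous_on A (prim T g)"
proof -
  have "continuous (at t within UNIV) (prim T g)" for t
    unfolding continuous_within_sequentially
  proof (intro allI impI)
    fix x :: "nat \<Rightarrow> real" assume x: "(\<forall>n. x n \<in> UNIV) \<and> x \<longlonglongrightarrow> t"
    show "(prim T g \<circ> x) \<longlonglongrightarrow> prim T g t"
      unfolding prim_def comp_def
    proof (rule integral_dominated_convergence[where w="\<lambda>s. \<bar>g s\<bar>"])
      \<comment> \<open>At \<open>s = t\<close> the indicators need not converge, but a single point
        is null.\<close>
      show "AE s in leb T. (\<lambda>n. indicator {..x n} s * g s) \<longlonglongrightarrow> indicator {..t} s * g s"
        using AE_leb_neq[of t T]
      proof eventually_elim
        fix s assume "s \<noteq> t"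
        then consider "s < t" | "t < s" by linarith
        then show "(\<lambda>n. indicator {..x n} s * g s) \<longlonglongrightarrow> indicator {..t} s * g s"
        proof cases
          case 1
          then have "eventually (\<lambda>n. s < x n) sequentially" using x order_tendstoD by blast
          then have "eventually (\<lambda>n. indicator {..x n} s * g s = indicator {..t} s * g s) sequentially"
            by eventually_elim (use 1 in auto)
          then show ?thesis by (rule tendsto_eventually)
        next
          case 2
          then have "eventually (\<lambda>n. x n < s) sequentially" using x order_tendstoD by blast
          then have "eventually (\<lambda>n. indicator {..x n} s * g s = indicator {..t} s * g s) sequentially"
            by eventually_elim (use 2 in auto)
          then show ?thesis by (rule tendsto_eventually)
        qed
      qed
    qed (use g in \<open>auto simp: indicator_def integrable_indicator_atMost\<close>)
  qed
  then show ?thesis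
    by (intro continuous_at_imp_continuous_on) auto
qed

lemma borel_measurable_prim:
  assumes "integrable (leb T) g"
  shows "prim T g \<in> borel_measurable borel"
  using continuous_on_prim[OF assms] by (rule borel_measurable_continuous_onI)

lemma abs_prim_le:
  assumes "integrable (leb T) g"
  shows "\<bar>prim T g t\<bar> \<le> (LINT s|leb T. \<bar>g s\<bar>)"
proof -
  have "\<bar>prim T g t\<bar> \<le> (LINT s|leb T. \<bar>indicator {..t} s * g s\<bar>)"
    unfolding prim_def by (rule integral_abs_bound)
  also have "\<dots> \<le> (LINT s|leb T. \<bar>g s\<bar>)"
    using assms integrable_indicator_atMost[OF assms, of t]
    by (intro integral_mono) (auto simp: indicator_def)
  finally show ?thesis .
qed

lemma integrable_prim_mult:
  assumes "integrable (leb T) f" "integrable (leb T) g"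
  shows "integrable (leb T) (\<lambda>s. prim T f s * g s)"
  by (rule integrable_leb_bounded_mult[OF assms(2) borel_measurable_leb])
     (auto intro: borel_measurable_prim abs_prim_le assms)

text \<open>Fubini over the two triangles \<open>s \<le> r\<close> and \<open>r \<le> s\<close>.\<close>

lemma integral_prim_mult_total:
  assumes f: "integrable (leb T) f" and g: "integrable (leb T) g"
  shows "(LINT s|leb T. prim T f s * g s + f s * prim T g s) = (LINT s|leb T. f s) * (LINT s|leb T. g s)"
proof -
  interpret P: pair_sigma_finite "leb T" "leb T" ..
  let ?M = "leb T \<Otimes>\<^sub>M leb T"
  have [measurable]: "f \<in> borel_measurable (leb T)" "g \<in> borel_measurable (leb T)"
    using f g by auto
  have [measurable]: "(\<lambda>x. fst x) \<in> borel_measurable ?M" "(\<lambda>x. snd x) \<in> borel_measurable ?M"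
    by (auto intro!: measurable_compose[OF measurable_fst] measurable_compose[OF measurable_snd])
  let ?fg = "\<lambda>(s,r). f s * g r"
  have fg: "integrable ?M ?fg"
    using f g by (intro P.Fubini_integrable) (auto simp: abs_mult)
  have i1: "integrable ?M (\<lambda>(s,r). (if s \<le> r then 1 else 0) * (f s * g r))"
    by (rule Bochner_Integration.integrable_bound[OF fg]) (auto simp: split_beta)
  have i2: "integrable ?M (\<lambda>(s,r). (if r \<le> s then 1 else 0) * (f s * g r))"
    by (rule Bochner_Integration.integrable_bound[OF fg]) (auto simp: split_beta)
  have *: "(LINT s|leb T. (if s \<le> r then 1 else 0) * (f s * g r)) = prim T f r * g r" for r
  proof -
    have "prim T f r * g r = (LINT s|leb T. (indicator {..r} s * f s) * g r)"
      unfolding prim_def by simp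
    also have "\<dots> = (LINT s|leb T. (if s \<le> r then 1 else 0) * (f s * g r))"
      unfolding Bochner_Integration.integral_mult_left_zero[symmetric]
      by (rule Bochner_Integration.integral_cong) (auto split: split_indicator)
    finally show ?thesis by simp
  qed
  have **: "(LINT r|leb T. (if r \<le> s then 1 else 0) * (f s * g r)) = f s * prim T g s" for s
  proof -
    have "f s * prim T g s = (LINT r|leb T. f s * (indicator {..s} r * g r))"
      unfolding prim_def by simp
    also have "\<dots> = (LINT r|leb T. (if r \<le> s then 1 else 0) * (f s * g r))"
      by (rule Bochner_Integration.integral_cong) (auto split: split_indicator)
    finally show ?thesis by simp
  qed
  have "(LINT s|leb T. prim T f s * g s + f s * prim T g s)
      = (LINT s|leb T. prim T f s * g s) + (LINT s|leb T. f s * prim T g s)"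
    using integrable_prim_mult[OF f g] integrable_prim_mult[OF g f]
    by (intro Bochner_Integration.integral_add) (auto simp: mult.commute)
  also have "(LINT s|leb T. prim T f s * g s) = (LINT x|?M. (case x of (s,r) \<Rightarrow> (if s \<le> r then 1 else 0) * (f s * g r)))"
    unfolding *[symmetric] by (rule P.integral_snd[OF i1])
  also have "(LINT s|leb T. f s * prim T g s) = (LINT x|?M. (case x of (s,r) \<Rightarrow> (if r \<le> s then 1 else 0) * (f s * g r)))"
    unfolding **[symmetric] using P.integral_fst'[OF i2] by simp
  also have "(LINT x|?M. (case x of (s,r) \<Rightarrow> (if s \<le> r then 1 else 0) * (f s * g r))) +
      (LINT x|?M. (case x of (s,r) \<Rightarrow> (if r \<le> s then 1 else 0) * (f s * g r)))
     = (LINT x|?M. (case x of (s,r) \<Rightarrow> (if s \<le> r then 1 else 0) * (f s * g r) + (if r \<le> s then 1 else 0) * (f s * g r)))"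
    by (subst Bochner_Integration.integral_add[OF i1 i2, symmetric])
       (auto intro!: Bochner_Integration.integral_cong)
  also have "\<dots> = (LINT x|?M. ?fg x)"
  proof (rule integral_cong_AE)
    \<comment> \<open>Both triangles contain the diagonal, so the indicators add up to 1 only off a
      null set of the product.\<close>
    have "AE x in ?M. fst x \<noteq> snd x"
    proof (rule P.AE_pair_measure)
      show "{x \<in> space ?M. fst x \<noteq> snd x} \<in> sets ?M" by measurable
      show "AE x in leb T. AE y in leb T. fst (x, y) \<noteq> snd (x, y)"
        unfolding fst_conv snd_conv by (subst eq_commute) (intro AE_I2 AE_leb_neq)
    qed
    then show "AE x in ?M. (case x of (s,r) \<Rightarrow> (if s \<le> r then 1 else 0) * (f s * g r) + (if r \<le> s then 1 else 0) * (f s * g r)) = ?fg x"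
      by eventually_elim auto
  qed (auto simp: split_beta)
  also have "\<dots> = (LINT s|leb T. LINT r|leb T. f s * g r)"
    using P.integral_fst'[OF fg] by simp
  also have "\<dots> = (LINT s|leb T. f s) * (LINT s|leb T. g s)" by simp
  finally show ?thesis .
qed

text \<open>The identity for the total integrals is applied to \<open>f\<close> and \<open>g\<close>
  truncated to \<open>{..t}\<close>; truncation does not change the indefinite integrals up to
  \<open>t\<close>.\<close>

lemma prim_mult_prim:
  assumes f: "integrable (leb T) f" and g: "integrable (leb T) g"
  shows "prim T f t * prim T g t = prim T (\<lambda>s. prim T f s * g s + f s * prim T g s) t"
proof -
  let ?i = "indicator {..t} :: real \<Rightarrow> real"
  have eq: "s \<le> t \<Longrightarrow> prim T (\<lambda>s. ?i s * h s) s = prim T h s" for s h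
    unfolding prim_def by (rule Bochner_Integration.integral_cong) (auto simp: indicator_def)
  have "prim T f t * prim T g t = (LINT s|leb T. ?i s * f s) * (LINT s|leb T. ?i s * g s)"
    by (simp add: prim_def)
  also have "\<dots> = (LINT s|leb T. prim T (\<lambda>s. ?i s * f s) s * (?i s * g s) + (?i s * f s) * prim T (\<lambda>s. ?i s * g s) s)"
    by (rule integral_prim_mult_total[symmetric]) (intro integrable_indicator_atMost f g)+
  also have "\<dots> = prim T (\<lambda>s. prim T f s * g s + f s * prim T g s) t"
    unfolding prim_def[of T "\<lambda>s. prim T f s * g s + f s * prim T g s"]
    by (rule Bochner_Integration.integral_cong) (auto simp: eq split: split_indicator)
  finally show ?thesis .
qed

text \<open>
  \<open>ac T F f\<close>: \<open>F\<close> is absolutely continuous with almost-everywhere derivative \<open>f\<close>, in the sense that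
  \<open>F\<close> is an indefinite integral of \<open>f\<close>.
\<close>

definition ac :: "real \<Rightarrow> (real \<Rightarrow> real) \<Rightarrow> (real \<Rightarrow> real) \<Rightarrow> bool" where
  "ac T F f \<longleftrightarrow> integrable (leb T) f \<and> (\<forall>t\<in>{0..T}. F t - F 0 = prim T f t)"

lemma ac_integrable: "ac T F f \<Longrightarrow> integrable (leb T) f"
  by (simp add: ac_def)

lemma prim_ac: "ac T F f \<Longrightarrow> 0 \<le> t \<Longrightarrow> t \<le> T \<Longrightarrow> prim T f t = F t - F 0"
  by (simp add: ac_def)

lemma ac_eq: "ac T F f \<Longrightarrow> 0 < t \<Longrightarrow> t \<le> T \<Longrightarrow> F t = F 0 + prim T f t"
  unfolding ac_def by (metis add.commute atLeastAtMost_iff diff_add_cancel less_imp_le)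

lemma ac_T: "ac T F f \<Longrightarrow> 0 < T \<Longrightarrow> F T = F 0 + (LINT s|leb T. f s)"
  using ac_eq[of T F f T] by (simp add: prim_T)

lemma ac_prim: "integrable (leb T) f \<Longrightarrow> ac T (\<lambda>t. c + prim T f t) f"
  by (simp add: ac_def prim_0)

lemma ac_cong:
  assumes "ac T F f" "\<And>t. 0 \<le> t \<Longrightarrow> t \<le> T \<Longrightarrow> G t = F t" "AE t in leb T. g t = f t"
  shows "ac T G g"
proof -
  have fg: "AE t in leb T. f t = g t" using assms(3) by eventually_elim simp
  have "G t - G 0 = prim T g t" if "0 \<le> t" "t \<le> T" for t
    using assms(1,2) that prim_cong_AE[OF assms(3), of t] by (auto simp: ac_def)
  then show ?thesis
    using integrable_leb_AE[OF ac_integrable[OF assms(1)] fg] by (auto simp: ac_def)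
qed

lemma ac_continuous_on: "ac T F f \<Longrightarrow> continuous_on {0..T} F"
  using continuous_on_add[OF continuous_on_const continuous_on_prim, of T f "{0..T}" "F 0"]
  by (subst continuous_on_cong[OF refl, of _ _ "\<lambda>t. F 0 + prim T f t"])
     (auto simp: prim_ac dest: ac_integrable)

lemma ac_measurable:
  assumes "ac T F f"
  shows "F \<in> borel_measurable (leb T)"
proof (rule borel_measurable_leb_AE)
  show "(\<lambda>t. F 0 + prim T f t) \<in> borel_measurable (leb T)"
    using borel_measurable_prim[OF ac_integrable[OF assms]] by measurable
  show "AE t in leb T. F 0 + prim T f t = F t"
    by (rule AE_leb_I) (simp add: ac_eq[OF assms])
qed

lemma ac_bounded:
  assumes "ac T F f"
  shows "\<exists>B. \<forall>t\<in>{0..T}. \<bar>F t\<bar> \<le> B"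
  using compact_imp_bounded[OF compact_continuous_image[OF ac_continuous_on[OF assms] compact_Icc]]
  by (auto simp: bounded_iff)

lemma ac_mult_integrable:
  assumes "ac T F f" "integrable (leb T) g"
  shows "integrable (leb T) (\<lambda>t. F t * g t)" "integrable (leb T) (\<lambda>t. g t * F t)"
proof -
  obtain B where "\<forall>t\<in>{0..T}. \<bar>F t\<bar> \<le> B" using ac_bounded[OF assms(1)] by auto
  then show "integrable (leb T) (\<lambda>t. F t * g t)"
    by (intro integrable_leb_bounded_mult[OF assms(2) ac_measurable[OF assms(1)], of B]) auto
  then show "integrable (leb T) (\<lambda>t. g t * F t)" by (simp add: mult.commute)
qed

lemma ac_self_integrable: "ac T F f \<Longrightarrow> integrable (leb T) F"
  using ac_mult_integrable(1)[of T F f "\<lambda>_. 1"] by simp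

lemma ac_const: "ac T (\<lambda>t. c) (\<lambda>t. 0)"
  by (simp add: ac_def prim_def)

lemma ac_add:
  assumes "ac T F f" "ac T G g"
  shows "ac T (\<lambda>t. F t + G t) (\<lambda>t. f t + g t)"
  unfolding ac_def by (simp add: prim_add ac_integrable[OF assms(1)] ac_integrable[OF assms(2)] prim_ac[OF assms(1)] prim_ac[OF assms(2)])

lemma ac_diff:
  assumes "ac T F f" "ac T G g"
  shows "ac T (\<lambda>t. F t - G t) (\<lambda>t. f t - g t)"
  unfolding ac_def by (simp add: prim_diff ac_integrable[OF assms(1)] ac_integrable[OF assms(2)] prim_ac[OF assms(1)] prim_ac[OF assms(2)])

lemma ac_cmult:
  assumes "ac T F f"
  shows "ac T (\<lambda>t. c * F t) (\<lambda>t. c * f t)"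
  unfolding ac_def by (simp add: ac_integrable[OF assms] prim_cmult prim_ac[OF assms] right_diff_distrib)

text \<open>With \<open>F = F 0 + prim T f\<close> and \<open>G = G 0 + prim T g\<close>, the
  product rule splits into \<open>prim_mult_prim\<close> and terms linear in \<open>f\<close> and
  \<open>g\<close>.\<close>

lemma ac_mult:
  assumes F: "ac T F f" and G: "ac T G g"
  shows "ac T (\<lambda>t. F t * G t) (\<lambda>t. f t * G t + F t * g t)"
  unfolding ac_def
proof (intro conjI ballI)
  note [simp] = ac_integrable[OF F] ac_integrable[OF G]
  show "integrable (leb T) (\<lambda>t. f t * G t + F t * g t)"
    by (intro Bochner_Integration.integrable_add ac_mult_integrable[OF F] ac_mult_integrable[OF G] ac_integrable[OF F] ac_integrable[OF G])
  fix t assume t: "t \<in> {0..T}"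
  have "prim T (\<lambda>t. f t * G t + F t * g t) t
     = prim T (\<lambda>t. (prim T f t * g t + f t * prim T g t) + (G 0 * f t + F 0 * g t)) t"
    by (intro prim_cong_AE AE_leb_I) (auto simp: ac_eq[OF F] ac_eq[OF G] algebra_simps)
  also have "\<dots> = prim T (\<lambda>t. prim T f t * g t + f t * prim T g t) t + G 0 * prim T f t + F 0 * prim T g t"
    using integrable_prim_mult[of T f g] integrable_prim_mult[of T g f]
    by (subst prim_add) (auto simp: prim_add prim_cmult mult.commute)
  also have "\<dots> = prim T f t * prim T g t + G 0 * prim T f t + F 0 * prim T g t"
    by (simp add: prim_mult_prim)
  finally have "F t * G t - F 0 * G 0 = prim T (\<lambda>t. f t * G t + F t * g t) t"
    if "0 < t" using t that by (simp add: ac_eq[OF F, of t] ac_eq[OF G, of t] algebra_simps)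
  then show "F t * G t - F 0 * G 0 = prim T (\<lambda>t. f t * G t + F t * g t) t"
    using t by (cases "t = 0") (auto simp: prim_0)
qed

lemma ac_parts:
  assumes F: "ac T F f" and G: "ac T G g" and "0 < T"
  shows "(LINT t|leb T. f t * G t) = F T * G T - F 0 * G 0 - (LINT t|leb T. F t * g t)"
  using ac_T[OF ac_mult[OF F G] \<open>0 < T\<close>]
  by (simp add: Bochner_Integration.integral_add ac_mult_integrable[OF F ac_integrable[OF G]] ac_mult_integrable[OF G ac_integrable[OF F]])

text \<open>The bridge from pointwise derivatives to indefinite integrals by the fundamental theorem
  of calculus. It feeds in the explicit functions: test functions, the weight, trigonometric
  functions and the identity.\<close>

lemma ac_C1:
  assumes der: "\<And>t. (F has_real_derivative f t) (at t)" and cont: "continuous_on UNIV f"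
  shows "ac T F f"
  unfolding ac_def
proof (intro conjI ballI)
  have "set_integrable lborel {0..T} f"
    using cont by (intro borel_integrable_atLeastAtMost') (auto intro: continuous_on_subset)
  then have "set_integrable lborel {0<..<T} f" by (rule set_integrable_subset) auto
  then have 1: "integrable lborel (\<lambda>t. indicator {0<..<T} t *\<^sub>R f t)" unfolding set_integrable_def by simp
  then show i: "integrable (leb T) f"
    by (subst integrable_restrict_space) (auto simp: integrable_completion)
  fix t assume t: "t \<in> {0..T}"
  have "prim T f t = (LINT s|lebesgue. indicator {0<..<T} s *\<^sub>R (indicator {..t} s * f s))"
    unfolding prim_def by (rule integral_restrict_space) auto
  also have "\<dots> = (LINT s|lborel. indicator {0<..<T} s *\<^sub>R (indicator {..t} s * f s))"
    using borel_measurable_continuous_onI[OF cont] by (intro integral_completion) measurable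
  also have "\<dots> = (LINT s|lborel. indicator {0..t} s *\<^sub>R f s)"
  proof (rule integral_cong_AE)
    show "AE s in lborel. indicator {0<..<T} s *\<^sub>R (indicator {..t} s * f s) = indicator {0..t} s *\<^sub>R f s"
      using AE_lborel_singleton[of 0] AE_lborel_singleton[of T] by eventually_elim (use t in \<open>auto simp: indicator_def\<close>)
  qed (use borel_measurable_continuous_onI[OF cont] in measurable)
  also have "\<dots> = F t - F 0"
    using t der cont by (intro integral_FTC_Icc) (auto simp: has_real_derivative_iff_has_vector_derivative[symmetric] intro: has_field_derivative_at_within continuous_on_subset)
  finally show "F t - F 0 = prim T f t" by simp
qed

section \<open>Test functions\<close>

definition smooth :: "(real \<Rightarrow> real) \<Rightarrow> bool" where
  "smooth f \<longleftrightarrow> (\<forall>k x. (deriv ^^ k) f differentiable (at x))"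

text \<open>Formulas for the k-th derivative are avoided: a class of differentiable functions that
  \<open>deriv\<close> maps into itself suffices.\<close>

lemma smooth_coinduct:
  assumes "f \<in> A" and A: "\<And>f. f \<in> A \<Longrightarrow> (\<forall>x. f differentiable (at x)) \<and> deriv f \<in> A"
  shows "smooth f"
proof -
  have "(deriv ^^ k) f \<in> A" for k
    using assms by (induction k) auto
  then show ?thesis using A by (auto simp: smooth_def)
qed

lemma smooth_differentiable: "smooth f \<Longrightarrow> f differentiable (at x)"
  unfolding smooth_def by (metis funpow_0)

lemma smooth_DERIV: "smooth f \<Longrightarrow> (f has_real_derivative deriv f x) (at x)"
  using smooth_differentiable DERIV_deriv_iff_real_differentiable by blast

lemma smooth_deriv: "smooth f \<Longrightarrow> smooth (deriv f)"
  unfolding smooth_def by (metis funpow_Suc_right o_apply)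

lemma smooth_deriv_iff:
  assumes "\<And>x. (f has_real_derivative f' x) (at x)"
  shows "smooth f \<longleftrightarrow> smooth f'"
proof -
  have d: "deriv f = f'" using assms DERIV_imp_deriv by blast
  have "smooth f" if f': "smooth f'"
    unfolding smooth_def
  proof (intro allI)
    fix k x show "(deriv ^^ k) f differentiable (at x)"
    proof (cases k)
      case 0
      then show ?thesis using assms real_differentiable_def by auto
    next
      case (Suc m)
      then show ?thesis using f' d by (simp add: funpow_Suc_right smooth_def del: funpow.simps)
    qed
  qed
  then show ?thesis using smooth_deriv d by blast
qed

lemma smooth_continuous_on: "smooth f \<Longrightarrow> continuous_on A f"
  using smooth_DERIV DERIV_isCont continuous_at_imp_continuous_on by blast

text \<open>By the Leibniz rule single products are not closed under \<open>deriv\<close>, but their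
  finite sums are; this is the class for the coinduction.\<close>

inductive_set product_sums :: "(real \<Rightarrow> real) set" where
  prod: "smooth f \<Longrightarrow> smooth g \<Longrightarrow> (\<lambda>x. f x * g x) \<in> product_sums"
| sum: "f \<in> product_sums \<Longrightarrow> g \<in> product_sums \<Longrightarrow> (\<lambda>x. f x + g x) \<in> product_sums"

lemma smooth_product_sums:
  assumes "f \<in> product_sums"
  shows "smooth f"
proof (rule smooth_coinduct[OF assms])
  fix f assume "f \<in> product_sums"
  then show "(\<forall>x. f differentiable (at x)) \<and> deriv f \<in> product_sums"
  proof induction
    case (prod f g)
    have d: "((\<lambda>x. f x * g x) has_real_derivative (deriv f x * g x + f x * deriv g x)) (at x)" for x
      using prod by (auto intro!: derivative_eq_intros smooth_DERIV)
    then have "deriv (\<lambda>x. f x * g x) = (\<lambda>x. deriv f x * g x + f x * deriv g x)"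
      using DERIV_imp_deriv by blast
    then show ?case
      using d prod by (auto simp: real_differentiable_def intro!: product_sums.intros smooth_deriv)
  next
    case (sum f g)
    have d: "((\<lambda>x. f x + g x) has_real_derivative (deriv f x + deriv g x)) (at x)" for x
      using sum by (auto intro!: derivative_eq_intros simp: DERIV_deriv_iff_real_differentiable)
    then have "deriv (\<lambda>x. f x + g x) = (\<lambda>x. deriv f x + deriv g x)"
      using DERIV_imp_deriv by blast
    then show ?case
      using d sum by (auto simp: real_differentiable_def intro!: product_sums.intros)
  qed
qed

lemma smooth_mult: "smooth f \<Longrightarrow> smooth g \<Longrightarrow> smooth (\<lambda>x. f x * g x)"
  by (rule smooth_product_sums[OF product_sums.prod])

lemma smooth_const: "smooth (\<lambda>x. c)"
proof (rule smooth_coinduct[where A="range (\<lambda>c x. c)"])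
  fix f assume "f \<in> range (\<lambda>(c::real) (x::real). c)"
  then obtain c where f: "f = (\<lambda>x. c)" by auto
  show "(\<forall>x. f differentiable (at x)) \<and> deriv f \<in> range (\<lambda>(c::real) (x::real). c)"
    unfolding f by auto
qed auto

lemma smooth_add:
  assumes "smooth f" "smooth g"
  shows "smooth (\<lambda>x. f x + g x)"
proof -
  have "(\<lambda>x. f x * 1 + g x * 1) \<in> product_sums"
    by (intro product_sums.intros assms smooth_const)
  then show ?thesis using smooth_product_sums by simp
qed

lemma smooth_affine:
  assumes "smooth f"
  shows "smooth (\<lambda>x. f (a * x + b))"
\<comment> \<open>Each derivative brings out a factor \<open>a\<close>, hence the free scalar
  \<open>c\<close> in the class.\<close>
proof (rule smooth_coinduct[where A="{(\<lambda>x. c * f (a * x + b)) | c f. smooth f}"])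
  show "(\<lambda>x. f (a * x + b)) \<in> {(\<lambda>x. c * f (a * x + b)) | c f. smooth f}"
    using assms by (auto intro!: exI[of _ 1] exI[of _ f])
  fix g assume "g \<in> {(\<lambda>x. c * f (a * x + b)) | c f. smooth f}"
  then obtain c f where g: "g = (\<lambda>x. c * f (a * x + b))" and f: "smooth f" by auto
  have d: "(g has_real_derivative (c * a) * deriv f (a * x + b)) (at x)" for x
    unfolding g by (auto intro!: derivative_eq_intros DERIV_chain2[OF smooth_DERIV[OF f]])
  then have "deriv g = (\<lambda>x. (c * a) * deriv f (a * x + b))"
    using DERIV_imp_deriv by blast
  then show "(\<forall>x. g differentiable (at x)) \<and> deriv g \<in> {(\<lambda>x. c * f (a * x + b)) | c f. smooth f}"
    using d smooth_deriv[OF f] by (auto simp: real_differentiable_def)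
qed

text \<open>The functions \<open>p(1/x) exp(-c/x)\<close>, continued by zero to the left. The
  classical flat function is the case \<open>p = 1\<close>; admitting all polynomials makes the
  class closed under differentiation.\<close>

definition flat :: "real \<Rightarrow> real poly \<Rightarrow> real \<Rightarrow> real" where
  "flat c p x = (if 0 < x then poly p (1 / x) * exp (- (c / x)) else 0)"

lemma poly_exp_tendsto_0:
  fixes p :: "real poly"
  assumes "0 < c"
  shows "((\<lambda>x. poly p x * exp (- (c * x))) \<longlongrightarrow> 0) at_top"
proof -
  have mono: "((\<lambda>x. x ^ n * exp (- (c * x))) \<longlongrightarrow> 0) at_top" for n
  proof -
    have "((\<lambda>x. (1 / c ^ n) * ((c * x) ^ n / exp (c * x))) \<longlongrightarrow> (1 / c ^ n) * 0) at_top"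
      using assms
      by (intro tendsto_intros filterlim_compose[OF tendsto_power_div_exp_0])
         (auto intro!: filterlim_tendsto_pos_mult_at_top[OF tendsto_const] filterlim_ident)
    moreover have "(1 / c ^ n) * ((c * x) ^ n / exp (c * x)) = x ^ n * exp (- (c * x))" for x
      using assms by (simp add: power_mult_distrib exp_minus field_simps)
    ultimately show ?thesis by simp
  qed
  have "((\<lambda>x. \<Sum>i\<le>degree p. coeff p i * (x ^ i * exp (- (c * x)))) \<longlongrightarrow> (\<Sum>i\<le>degree p. coeff p i * 0)) at_top"
    by (intro tendsto_intros mono)
  then show ?thesis
    by (simp add: poly_altdef sum_distrib_right mult.assoc)
qed

text \<open>For \<open>x > 0\<close> the derivative of \<open>p(1/x) exp(-c/x)\<close> is
  \<open>(1/x)^2 (c p - p')(1/x) exp(-c/x)\<close>, and \<open>[:0, 0, 1:]\<close> is the factor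
  \<open>(1/x)^2\<close>.\<close>

lemma flat_derivative:
  assumes "0 < c"
  shows "(flat c p has_real_derivative flat c ([:0, 0, 1:] * (smult c p - pderiv p)) x) (at x)"
proof (cases x "0 :: real" rule: linorder_cases)
  case less
  have "((\<lambda>x. 0) has_real_derivative 0) (at x)" by simp
  moreover have "\<forall>\<^sub>F y in nhds x. flat c p y = 0"
    using less eventually_nhds_in_open[of "{..<0}" x] by (auto elim!: eventually_mono simp: flat_def)
  ultimately show ?thesis
    using less by (subst DERIV_cong_ev[OF refl _ refl, of _ "\<lambda>x. 0"]) (auto simp: flat_def)
next
  case greater
  have "((\<lambda>x. poly p (1 / x) * exp (- (c / x))) has_real_derivative
      poly ([:0, 0, 1:] * (smult c p - pderiv p)) (1 / x) * exp (- (c / x))) (at x)"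
    using greater
    by (auto intro!: derivative_eq_intros DERIV_chain2[OF poly_DERIV] simp: field_simps power2_eq_square)
  moreover have "\<forall>\<^sub>F y in nhds x. flat c p y = poly p (1 / y) * exp (- (c / y))"
    using greater eventually_nhds_in_open[of "{0<..}" x] by (auto elim!: eventually_mono simp: flat_def)
  ultimately show ?thesis
    using greater by (subst DERIV_cong_ev[OF refl _ refl, of _ "\<lambda>x. poly p (1 / x) * exp (- (c / x))"]) (auto simp: flat_def)
next
  case equal
  \<comment> \<open>The denominator of the difference quotient at 0 is absorbed into the polynomial
    as one more factor \<open>1/h\<close>.\<close>
  have "((\<lambda>h. poly ([:0, 1:] * p) (inverse h) * exp (- (c * inverse h))) \<longlongrightarrow> 0) (at_right 0)"
    by (rule filterlim_compose[OF poly_exp_tendsto_0[OF assms] filterlim_inverse_at_top_right])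
  then have "((\<lambda>h. flat c p h / h) \<longlongrightarrow> 0) (at_right 0)"
    by (rule Lim_transform_eventually)
       (auto simp: flat_def eventually_at_filter divide_simps)
  moreover have "((\<lambda>h. flat c p h / h) \<longlongrightarrow> 0) (at_left 0)"
    by (rule tendsto_eventually) (auto simp: flat_def eventually_at_filter)
  ultimately have "((\<lambda>h. flat c p h / h) \<longlongrightarrow> 0) (at 0)"
    using filterlim_split_at by blast
  then show ?thesis
    using equal by (simp add: DERIV_def flat_def)
qed

lemma smooth_flat:
  assumes "0 < c"
  shows "smooth (flat c p)"
proof (rule smooth_coinduct[where A="range (flat c)"])
  fix f assume "f \<in> range (flat c)"
  then obtain q where f: "f = flat c q" by auto
  have "deriv f = flat c ([:0, 0, 1:] * (smult c q - pderiv q))"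
    unfolding f using flat_derivative[OF assms] DERIV_imp_deriv by blast
  then show "(\<forall>x. f differentiable (at x)) \<and> deriv f \<in> range (flat c)"
    unfolding f using flat_derivative[OF assms] by (auto simp: real_differentiable_def)
qed auto

text \<open>Positive exactly on \<open>(a, b)\<close>, and identically zero if
  \<open>b \<le> a\<close>, a case that does occur when indicators are approximated.\<close>

definition bump :: "real \<Rightarrow> real \<Rightarrow> real \<Rightarrow> real \<Rightarrow> real" where
  "bump a b c x = flat c 1 (1 * x + (- a)) * flat c 1 ((-1) * x + b)"

lemma smooth_bump: "0 < c \<Longrightarrow> smooth (bump a b c)"
  unfolding bump_def by (intro smooth_mult smooth_affine smooth_flat)

lemma bump_eq:
  "bump a b c x = (if a < x \<and> x < b then exp (- (c / (x - a))) * exp (- (c / (b - x))) else 0)"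
  by (simp add: bump_def flat_def)

lemma bump_bounds: "0 < c \<Longrightarrow> 0 \<le> bump a b c x \<and> bump a b c x \<le> 1"
  by (auto simp: bump_eq intro!: mult_le_one)

lemma bump_tendsto_indicator:
  "(\<lambda>n. bump a b (inverse (real (Suc n))) x) \<longlonglongrightarrow> indicator {a<..<b} x"
proof (cases "a < x \<and> x < b")
  case True
  have "(\<lambda>n. exp (- (inverse (real (Suc n)) / (x - a))) * exp (- (inverse (real (Suc n)) / (b - x))))
     \<longlonglongrightarrow> exp (- (0 / (x - a))) * exp (- (0 / (b - x)))"
    using True by (intro tendsto_intros LIMSEQ_inverse_real_of_nat) auto
  then show ?thesis using True by (simp add: bump_eq)
qed (auto simp: bump_eq)

section \<open>Test functions and their antiderivatives\<close>

lemma test_functions_iff: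
  "\<phi> \<in> test_functions T \<longleftrightarrow>
     smooth \<phi> \<and> (\<exists>a b. 0 < a \<and> b < T \<and> (\<forall>x. x \<notin> {a..b} \<longrightarrow> \<phi> x = 0))"
  by (simp add: test_functions_def smooth_def)

lemma test_function_bump:
  "0 < a \<Longrightarrow> b < T \<Longrightarrow> 0 < c \<Longrightarrow> bump a b c \<in> test_functions T"
  unfolding test_functions_iff using smooth_bump by (force simp: bump_eq)

lemma test_function_deriv:
  assumes "\<phi> \<in> test_functions T"
  shows "deriv \<phi> \<in> test_functions T"
proof -
  from assms obtain a b where ab: "0 < a" "b < T" "\<And>x. x \<notin> {a..b} \<Longrightarrow> \<phi> x = 0" and s: "smooth \<phi>"
    unfolding test_functions_iff by blast
  have "deriv \<phi> x = 0" if x: "x \<notin> {a..b}" for x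
  proof -
    have "\<forall>\<^sub>F y in nhds x. \<phi> y = 0"
      using x eventually_nhds_in_open[of "- {a..b}" x] ab(3) by (auto elim!: eventually_mono simp: open_Compl)
    then have "(\<phi> has_real_derivative 0) (at x)"
      by (subst DERIV_cong_ev[OF refl _ refl, of _ "\<lambda>x. 0"]) auto
    then show ?thesis by (rule DERIV_imp_deriv)
  qed
  then show ?thesis unfolding test_functions_iff using ab smooth_deriv[OF s] by blast
qed

lemma test_function_funpow_deriv: "\<phi> \<in> test_functions T \<Longrightarrow> (deriv ^^ k) \<phi> \<in> test_functions T"
  by (induction k) (auto intro: test_function_deriv)

lemma ac_test_function:
  assumes "\<phi> \<in> test_functions T"
  shows "ac T \<phi> (deriv \<phi>)"
  using assms smooth_DERIV smooth_deriv smooth_continuous_on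
  unfolding test_functions_iff by (intro ac_C1) auto

lemma test_function_boundary:
  assumes "\<phi> \<in> test_functions T"
  shows "\<phi> 0 = 0" "\<phi> T = 0"
  using assms unfolding test_functions_iff by (metis atLeastAtMost_iff not_less)+

text \<open>The antiderivative that vanishes at 0 is constant on either side of the support of
  \<open>\<phi>\<close>. The left constant is 0 by normalisation, and the right one is the integral
  of \<open>\<phi>\<close>.\<close>

lemma test_function_antiderivative:
  assumes \<phi>: "\<phi> \<in> test_functions T" and z: "(LINT t|leb T. \<phi> t) = 0" and T: "0 < T"
  shows "\<exists>\<psi>\<in>test_functions T. deriv \<psi> = \<phi>"
proof -
  from \<phi> obtain a b where ab: "0 < a" "b < T" "\<And>x. x \<notin> {a..b} \<Longrightarrow> \<phi> x = 0" and s: "smooth \<phi>"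
    unfolding test_functions_iff by blast
  have cont: "continuous_on A \<phi>" for A using s by (rule smooth_continuous_on)
  obtain \<psi> where \<psi>: "\<And>x. (\<psi> has_real_derivative \<phi> x) (at x)"
  proof -
    have "\<exists>\<psi>. \<forall>x::real. (\<psi> has_real_derivative \<phi> x) (at x)"
    proof -
      have *: "((\<lambda>x. LBINT y=0..x. \<phi> y) has_vector_derivative \<phi> x) (at x)" for x :: real
      proof -
        have "((\<lambda>u. LBINT y=ereal 0..u. \<phi> y) has_vector_derivative \<phi> x) (at x within {min 0 x - 1 .. max 0 x + 1})"
          by (rule interval_integral_FTC2) (auto intro: cont)
        then show ?thesis
          by (subst (asm) at_within_interior) (auto simp: zero_ereal_def)
      qed
      then show ?thesis by (auto simp: has_real_derivative_iff_has_vector_derivative)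
    qed
    then show ?thesis using that by blast
  qed
  define \<eta> where "\<eta> x = \<psi> x - \<psi> 0" for x
  have d: "(\<eta> has_real_derivative \<phi> x) (at x)" for x
    unfolding \<eta>_def using \<psi> by (auto intro!: derivative_eq_intros)
  have "ac T \<eta> \<phi>" using d cont by (rule ac_C1)
  then have "\<eta> T = 0" using z ac_T[of T \<eta> \<phi>] T by (simp add: \<eta>_def)
  have const: "\<eta> x = \<eta> y" if "\<And>t. min x y < t \<Longrightarrow> t < max x y \<Longrightarrow> \<phi> t = 0" for x y
  proof -
    have "\<eta> v = \<eta> u" if "u < v" and "\<And>t. u < t \<Longrightarrow> t < v \<Longrightarrow> \<phi> t = 0" for u v
      using that d by (intro DERIV_isconst_end) (auto intro: DERIV_isCont continuous_at_imp_continuous_on, metis)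
    from this[of x y] this[of y x] that show ?thesis
      by (cases x y rule: linorder_cases) (auto simp: min_def max_def)
  qed
  have "\<eta> x = 0" if x: "x \<notin> {a..b}" for x
  proof (cases "x < a")
    case True
    then have "\<eta> x = \<eta> 0" using ab by (intro const) (auto simp: min_def max_def split: if_splits)
    then show ?thesis by (simp add: \<eta>_def)
  next
    case False
    then have "\<eta> x = \<eta> T" using ab x by (intro const) (auto simp: min_def max_def split: if_splits)
    then show ?thesis using \<open>\<eta> T = 0\<close> by simp
  qed
  moreover have "smooth \<eta>" using smooth_deriv_iff[OF d] s by simp
  ultimately have "\<eta> \<in> test_functions T" unfolding test_functions_iff using ab by blast
  moreover have "deriv \<eta> = \<phi>" using d DERIV_imp_deriv by blast
  ultimately show ?thesis by blast
qed

text \<open>Half-lines are stable under intersection and generate the Borel sets, so the integral of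
  \<open>g\<close> vanishes over every Borel set by Dynkin's theorem. A Lebesgue set is a Borel set
  up to a null set, and a density with vanishing integrals is zero.\<close>

lemma AE_zero_if_prim_zero:
  assumes g: "integrable (leb T) g" and z: "\<And>t. prim T g t = 0"
  shows "AE t in leb T. g t = 0"
proof (rule leb.density_zero[OF g])
  have borel: "(LINT t|leb T. indicator B t * g t) = 0" if "B \<in> sets borel" for B :: "real set"
  proof -
    have "Int_stable (range (\<lambda>a::real. {..a}))"
      by (auto simp: Int_stable_def)
    moreover have "range (\<lambda>a::real. {..a}) \<subseteq> Pow UNIV" by auto
    moreover from that have "B \<in> sigma_sets UNIV (range (\<lambda>a::real. {..a}))"
      by (subst (asm) borel_eq_atMost) auto
    ultimately show ?thesis
    proof (induction rule: sigma_sets_induct_disjoint)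
      case (basic A)
      then show ?case using z by (auto simp: prim_def)
    next
      case empty
      then show ?case by simp
    next
      case (compl A)
      have [measurable]: "A \<in> sets borel" using compl by (subst borel_eq_atMost) auto
      have "(LINT t|leb T. indicator (UNIV - A) t * g t) = (LINT t|leb T. g t - indicator A t * g t)"
        by (rule Bochner_Integration.integral_cong) (auto simp: indicator_def)
      also have "\<dots> = (LINT t|leb T. g t) - (LINT t|leb T. indicator A t * g t)"
        using g by (intro Bochner_Integration.integral_diff integrable_leb_bounded_mult[where B=1]) (auto simp: indicator_def)
      also have "(LINT t|leb T. g t) = 0" using z[of T] by (simp add: prim_T)
      finally show ?case using compl by simp
    next
      case (union A)
      have [measurable]: "A i \<in> sets borel" for i using union by (subst borel_eq_atMost) auto
      have "(\<lambda>n. LINT t|leb T. (\<Sum>i<n. indicator (A i) t) * g t) \<longlonglongrightarrow> (LINT t|leb T. indicator (\<Union>i. A i) t * g t)"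
      proof (rule integral_dominated_convergence[where w="\<lambda>t. \<bar>g t\<bar>"])
        have s: "(\<lambda>i. indicator (A i) t :: real) sums indicator (\<Union>i. A i) t" for t
          using union by (intro indicator_sums) (auto simp: disjoint_family_on_def)
        show "AE t in leb T. (\<lambda>n. (\<Sum>i<n. indicator (A i) t) * g t) \<longlonglongrightarrow> indicator (\<Union>i. A i) t * g t"
          using s by (intro AE_I2 tendsto_intros) (simp add: sums_def)
        show "AE t in leb T. norm ((\<Sum>i<n. indicator (A i) t) * g t) \<le> \<bar>g t\<bar>" for n
        proof (rule AE_I2)
          fix t
          have "(\<Sum>i<n. indicator (A i) t :: real) \<le> indicator (\<Union>i. A i) t"
            using sum_le_suminf[OF sums_summable[OF s], of "{..<n}" t] sums_unique[OF s, of t] by auto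
          also have "\<dots> \<le> 1" by (simp add: indicator_def)
          finally have "\<bar>\<Sum>i<n. indicator (A i) t :: real\<bar> \<le> 1" by (simp add: sum_nonneg)
          from mult_right_mono[OF this, of "\<bar>g t\<bar>"]
          show "norm ((\<Sum>i<n. indicator (A i) t) * g t) \<le> \<bar>g t\<bar>" by (simp add: abs_mult)
        qed
      qed (use g in auto)
      moreover have "(LINT t|leb T. (\<Sum>i<n. indicator (A i) t) * g t) = 0" for n
      proof -
        have "(LINT t|leb T. (\<Sum>i<n. indicator (A i) t) * g t) = (\<Sum>i<n. LINT t|leb T. indicator (A i) t * g t)"
          unfolding sum_distrib_right
          using g by (intro Bochner_Integration.integral_sum integrable_leb_bounded_mult[where B=1]) (auto simp: indicator_def)
        then show ?thesis using union by simp
      qed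
      ultimately have "(\<lambda>n. 0) \<longlonglongrightarrow> (LINT t|leb T. indicator (\<Union>i. A i) t * g t)" by (simp only:)
      then show ?case by (simp only: LIMSEQ_const_iff)
    qed
  qed
  fix A assume "A \<in> sets (leb T)"
  then have "A \<in> sets lebesgue" by (simp add: sets_restrict_space_iff)
  then obtain S N N' where A: "A = S \<union> N" "N \<subseteq> N'" "N' \<in> null_sets lborel" "S \<in> sets lborel"
    by (rule sets_completionE)
  have "AE t in lebesgue. t \<notin> N'"
    by (intro AE_completion AE_not_in A)
  then have "AE t in leb T. indicator A t *\<^sub>R g t = indicator S t * g t"
    unfolding AE_leb_iff by eventually_elim (use A in \<open>auto simp: indicator_def\<close>)
  from integral_leb_AE[OF this] show "set_lebesgue_integral (leb T) A g = 0"
    using borel[of S] A by (simp add: set_lebesgue_integral_def)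
qed

section \<open>Weak derivatives\<close>

lemma L1_loc_indicator:
  assumes v: "v \<in> L1_loc T" and ab: "0 < a" "b < T"
  shows "integrable (leb T) (\<lambda>t. indicator {a..b} t * v t)"
proof -
  have "integrable lebesgue (\<lambda>t. indicator {a..b} t *\<^sub>R v t)"
    using v ab by (auto simp: L1_loc_def set_integrable_def)
  moreover have "(\<lambda>t. indicator {0<..<T} t *\<^sub>R (indicator {a..b} t * v t)) = (\<lambda>t. indicator {a..b} t *\<^sub>R v t)"
    using ab by (auto simp: indicator_def)
  ultimately show ?thesis
    by (subst integrable_restrict_space) (simp_all only: sets.Int_space_eq2 sets_completionI_sets greaterThanLessThan_borel sets_lborel)
qed

lemma L1_loc_test_integrable:
  assumes v: "v \<in> L1_loc T" and \<phi>: "\<phi> \<in> test_functions T"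
  shows "integrable (leb T) (\<lambda>t. v t * \<phi> t)"
proof -
  from \<phi> obtain a b where ab: "0 < a" "b < T" "\<And>x. x \<notin> {a..b} \<Longrightarrow> \<phi> x = 0"
    unfolding test_functions_iff by blast
  from ab v have "integrable (leb T) (\<lambda>t. indicator {a..b} t * v t)"
    by (intro L1_loc_indicator)
  from ac_mult_integrable(2)[OF ac_test_function[OF \<phi>] this]
  have "integrable (leb T) (\<lambda>t. indicator {a..b} t * v t * \<phi> t)" .
  moreover have "(\<lambda>t. indicator {a..b} t * v t * \<phi> t) = (\<lambda>t. v t * \<phi> t)"
    using ab(3) by (force simp: indicator_def)
  ultimately show ?thesis by simp
qed

lemma integrable_imp_L1_loc:
  assumes "integrable (leb T) v"
  shows "v \<in> L1_loc T"
  unfolding L1_loc_def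
proof (intro CollectI allI impI)
  fix a b :: real assume ab: "0 < a" "b < T"
  have "integrable lebesgue (\<lambda>t. indicator {0<..<T} t *\<^sub>R v t)"
    using assms by (subst (asm) integrable_restrict_space) auto
  then have "set_integrable lebesgue {0<..<T} v" by (simp add: set_integrable_def)
  then show "set_integrable lebesgue {a..b} v"
    by (rule set_integrable_subset) (use ab in auto)
qed

lemma L1_loc_AE:
  assumes u: "u \<in> L1_loc T" and ae: "AE t in leb T. u t = v t"
  shows "v \<in> L1_loc T"
  unfolding L1_loc_def
proof (intro CollectI allI impI)
  fix a b :: real assume ab: "0 < a" "b < T"
  have i: "integrable lebesgue (\<lambda>t. indicator {a..b} t *\<^sub>R u t)"
    using u ab by (auto simp: L1_loc_def set_integrable_def)
  have eq: "AE t in lebesgue. indicator {a..b} t *\<^sub>R u t = indicator {a..b} t *\<^sub>R v t"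
    using ae unfolding AE_leb_iff by eventually_elim (use ab in \<open>auto simp: indicator_def\<close>)
  show "set_integrable lebesgue {a..b} v"
    unfolding set_integrable_def
    by (rule integrable_cong_AE_imp[OF i]) (use borel_measurable_AE[OF _ eq] i eq in auto)
qed

lemma L1_loc_diff:
  assumes "u \<in> L1_loc T" "v \<in> L1_loc T"
  shows "(\<lambda>t. u t - v t) \<in> L1_loc T"
  using assms set_integral_diff(1) unfolding L1_loc_def by blast

text \<open>As \<open>c\<close> tends to zero, \<open>bump a b c\<close> tends boundedly to the indicator of \<open>(a, b)\<close>.\<close>

lemma AE_zero_if_test_integrals_zero:
  assumes v: "v \<in> L1_loc T" and z: "\<And>\<phi>. \<phi> \<in> test_functions T \<Longrightarrow> (LINT t|leb T. v t * \<phi> t) = 0"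
  shows "AE t in leb T. v t = 0"
proof -
  have "AE t in leb T. indicator {a..b} t * v t = 0" if ab: "0 < a" "b < T" for a b
  proof (rule AE_zero_if_prim_zero)
    let ?g = "\<lambda>t. indicator {a..b} t * v t"
    from v ab show g: "integrable (leb T) ?g" by (intro L1_loc_indicator)
    then have gm: "?g \<in> borel_measurable (leb T)" by auto
    fix t
    \<comment> \<open>Up to end points, the product of the indicators of \<open>{..t}\<close> and
      \<open>{a..b}\<close> is the indicator of \<open>(a, m)\<close>, the limit of admissible bump
      functions.\<close>
    define m where "m = min t b"
    have bm [measurable]: "bump a m c \<in> borel_measurable borel" if "0 < c" for c
      using smooth_continuous_on[OF smooth_bump[OF that]] by (rule borel_measurable_continuous_onI)
    have "(\<lambda>n. LINT s|leb T. bump a m (inverse (real (Suc n))) s * ?g s) \<longlonglongrightarrow> (LINT s|leb T. indicator {..t} s * ?g s)"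
    proof (rule integral_dominated_convergence[where w="\<lambda>s. \<bar>?g s\<bar>"])
      show "AE s in leb T. (\<lambda>n. bump a m (inverse (real (Suc n))) s * ?g s) \<longlonglongrightarrow> indicator {..t} s * ?g s"
        using AE_leb_neq[of a T] AE_leb_neq[of m T]
      proof eventually_elim
        fix s assume s: "s \<noteq> a" "s \<noteq> m"
        have "(\<lambda>n. bump a m (inverse (real (Suc n))) s * ?g s) \<longlonglongrightarrow> indicator {a<..<m} s * ?g s"
          by (intro tendsto_intros bump_tendsto_indicator)
        moreover have "indicator {a<..<m} s * ?g s = indicator {..t} s * ?g s"
          using s by (auto simp: indicator_def m_def min_def split: if_splits)
        ultimately show "(\<lambda>n. bump a m (inverse (real (Suc n))) s * ?g s) \<longlonglongrightarrow> indicator {..t} s * ?g s"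
          by simp
      qed
      show "AE s in leb T. norm (bump a m (inverse (real (Suc n))) s * ?g s) \<le> \<bar>?g s\<bar>" for n
        using bump_bounds[of "inverse (real (Suc n))" a m]
        by (intro AE_I2) (simp add: abs_mult mult_left_le_one_le)
      show "(\<lambda>s. indicator {..t} s * ?g s) \<in> borel_measurable (leb T)"
        using integrable_indicator_atMost[OF g] by auto
      show "(\<lambda>s. bump a m (inverse (real (Suc n))) s * ?g s) \<in> borel_measurable (leb T)" for n
        using bm[of "inverse (real (Suc n))"] by (intro borel_measurable_times[OF borel_measurable_leb gm]) auto
    qed (use g in auto)
    moreover have "(LINT s|leb T. bump a m (inverse (real (Suc n))) s * ?g s) = 0" for n
    proof -
      have "(\<lambda>s. bump a m c s * ?g s) = (\<lambda>s. v s * bump a m c s)" for c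
        by (auto simp: bump_eq m_def indicator_def)
      moreover have "m < T" using ab by (simp add: m_def)
      ultimately show ?thesis
        using z[OF test_function_bump[of a m T "inverse (real (Suc n))"]] ab by (simp only:) simp
    qed
    ultimately have "(\<lambda>n. 0) \<longlonglongrightarrow> (LINT s|leb T. indicator {..t} s * ?g s)" by (simp only:)
    then show "prim T ?g t = 0" unfolding prim_def by (simp only: LIMSEQ_const_iff)
  qed
  \<comment> \<open>Local integrability only reaches compact subintervals; countably many of them
    exhaust \<open>(0, T)\<close>.\<close>
  then have "AE t in leb T. indicator {inverse (real (Suc n))..T - inverse (real (Suc n))} t * v t = 0" for n
    by simp
  then have "AE t in leb T. \<forall>n. indicator {inverse (real (Suc n))..T - inverse (real (Suc n))} t * v t = 0"
    unfolding AE_all_countable by blast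
  moreover have "AE t in leb T. 0 < t \<and> t < T" by (rule AE_leb_I) auto
  ultimately show ?thesis
  proof eventually_elim
    fix t assume *: "\<forall>n. indicator {inverse (real (Suc n))..T - inverse (real (Suc n))} t * v t = 0"
      and t: "0 < t \<and> t < T"
    obtain n where "inverse (real (Suc n)) < min t (T - t)"
      using reals_Archimedean[of "min t (T - t)"] t by auto
    then show "v t = 0" using *[rule_format, of n] by (auto simp: indicator_def split: if_splits)
  qed
qed

lemma weak_derivD:
  assumes "weak_deriv T k u v"
  shows "u \<in> L1_loc T" "v \<in> L1_loc T"
    and "\<phi> \<in> test_functions T \<Longrightarrow>
      (LINT t|leb T. u t * (deriv ^^ k) \<phi> t) = (-1) ^ k * (LINT t|leb T. v t * \<phi> t)"
  using assms unfolding weak_deriv_def by blast+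

lemma weak_deriv_unique:
  assumes "weak_deriv T k u v" "weak_deriv T k u w"
  shows "AE t in leb T. v t = w t"
proof -
  have "AE t in leb T. v t - w t = 0"
  proof (rule AE_zero_if_test_integrals_zero)
    show "(\<lambda>t. v t - w t) \<in> L1_loc T" by (intro L1_loc_diff weak_derivD(2)[OF assms(1)] weak_derivD(2)[OF assms(2)])
    fix \<phi> assume \<phi>: "\<phi> \<in> test_functions T"
    have "(-1) ^ k * (LINT t|leb T. v t * \<phi> t) = (-1) ^ k * (LINT t|leb T. w t * \<phi> t)"
      using weak_derivD(3)[OF assms(1) \<phi>] weak_derivD(3)[OF assms(2) \<phi>] by (simp only:)
    then have "(LINT t|leb T. v t * \<phi> t) = (LINT t|leb T. w t * \<phi> t)" by simp
    moreover have "integrable (leb T) (\<lambda>t. v t * \<phi> t)" "integrable (leb T) (\<lambda>t. w t * \<phi> t)"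
      by (intro L1_loc_test_integrable \<phi> weak_derivD(2)[OF assms(1)] weak_derivD(2)[OF assms(2)])+
    ultimately show "(LINT t|leb T. (v t - w t) * \<phi> t) = 0"
      by (simp add: left_diff_distrib)
  qed
  then show ?thesis by simp
qed

text \<open>This disposes of the choice in \<open>wD\<close>: any weak derivative at hand may take
  its place under integrals and norms.\<close>

lemma AE_wD:
  assumes "weak_deriv T k u v"
  shows "AE t in leb T. wD T k u t = v t"
  using weak_deriv_unique[OF someI[of "weak_deriv T k u", OF assms] assms] by (simp add: wD_def)

lemma weak_deriv_0: "u \<in> L1_loc T \<Longrightarrow> weak_deriv T 0 u u"
  by (simp add: weak_deriv_def)

text \<open>One integration by parts, with vanishing boundary terms, moves a derivative from the
  test function onto \<open>V\<close>. Iteration turns a chain of absolutely continuous derivatives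
  into weak derivatives of higher order.\<close>

lemma weak_deriv_Suc:
  assumes u: "AE t in leb T. u t = V t" and V: "ac T V v" and w: "weak_deriv T k v w" and T: "0 < T"
  shows "weak_deriv T (Suc k) u w"
  unfolding weak_deriv_def
proof (intro conjI ballI)
  have "AE t in leb T. V t = u t" using u by eventually_elim simp
  then show "u \<in> L1_loc T" using L1_loc_AE integrable_imp_L1_loc[OF ac_self_integrable[OF V]] by blast
  show "w \<in> L1_loc T" using w by (rule weak_derivD(2))
  fix \<phi> assume \<phi>: "\<phi> \<in> test_functions T"
  let ?\<psi> = "(deriv ^^ k) \<phi>"
  have \<psi>: "?\<psi> \<in> test_functions T" using \<phi> by (rule test_function_funpow_deriv)
  have "(LINT t|leb T. u t * (deriv ^^ Suc k) \<phi> t) = (LINT t|leb T. V t * deriv ?\<psi> t)"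
    by (rule integral_leb_AE) (use u in eventually_elim, simp)
  also have "\<dots> = - (LINT t|leb T. v t * ?\<psi> t)"
    using ac_parts[OF V ac_test_function[OF \<psi>] T] test_function_boundary[OF \<psi>] by simp
  also have "\<dots> = (-1) ^ Suc k * (LINT t|leb T. w t * \<phi> t)"
    using weak_derivD(3)[OF w \<phi>] by simp
  finally show "(LINT t|leb T. u t * (deriv ^^ Suc k) \<phi> t) = (-1) ^ Suc k * (LINT t|leb T. w t * \<phi> t)" .
qed

text \<open>The argument of du Bois-Reymond: \<open>u - prim T v\<close> is orthogonal to the
  derivatives of test functions, that is, to the test functions of mean zero, and is therefore
  constant almost everywhere.\<close>

lemma weak_deriv_imp_ac:
  assumes uv: "weak_deriv T 1 u v" and u: "integrable (leb T) u" and v: "integrable (leb T) v" and T: "0 < T"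
  shows "\<exists>U. (AE t in leb T. u t = U t) \<and> ac T U v"
proof -
  define r where "r t = u t - prim T v t" for t
  have V: "ac T (\<lambda>t. 0 + prim T v t) v" using v by (rule ac_prim)
  have r: "integrable (leb T) r"
    unfolding r_def using u ac_self_integrable[OF V] by auto
  have rd: "(LINT t|leb T. r t * deriv \<phi> t) = 0" if \<phi>: "\<phi> \<in> test_functions T" for \<phi>
  proof -
    have i: "integrable (leb T) (\<lambda>t. w t * deriv \<phi> t)" if "integrable (leb T) w" for w
      using that by (intro L1_loc_test_integrable integrable_imp_L1_loc test_function_deriv \<phi>)
    have "(LINT t|leb T. r t * deriv \<phi> t) = (LINT t|leb T. u t * deriv \<phi> t) - (LINT t|leb T. prim T v t * deriv \<phi> t)"
      unfolding r_def using i[OF u] i[of "prim T v"] ac_self_integrable[OF V] by (simp add: left_diff_distrib)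
    also have "(LINT t|leb T. u t * deriv \<phi> t) = - (LINT t|leb T. v t * \<phi> t)"
      using weak_derivD(3)[OF uv \<phi>] by simp
    also have "(LINT t|leb T. prim T v t * deriv \<phi> t) = - (LINT t|leb T. v t * \<phi> t)"
      using ac_parts[OF V ac_test_function[OF \<phi>] T] test_function_boundary[OF \<phi>] by simp
    finally show ?thesis by simp
  qed
  have one: "(\<lambda>t. 1) \<in> L1_loc T" by (intro integrable_imp_L1_loc) simp
  \<comment> \<open>If every test function had mean zero, the constant 1 would vanish almost
    everywhere.\<close>
  have "\<exists>\<phi>0\<in>test_functions T. (LINT t|leb T. \<phi>0 t) \<noteq> 0"
  proof (rule ccontr)
    assume "\<not> ?thesis"
    then have "AE t in leb T. (1::real) = 0"
      using AE_zero_if_test_integrals_zero[OF one] by auto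
    from integral_leb_AE[OF this] show False
      using T by (simp add: measure_restrict_space)
  qed
  then obtain \<phi>0 where \<phi>0: "\<phi>0 \<in> test_functions T" and nz: "(LINT t|leb T. \<phi>0 t) \<noteq> 0" by auto
  define m where "m = (LINT t|leb T. \<phi>0 t)"
  \<comment> \<open>The only possible value of the constant, found by testing with
    \<open>\<phi>0\<close>.\<close>
  define c where "c = (LINT t|leb T. r t * \<phi>0 t) / m"
  have iphi: "integrable (leb T) \<phi>" if "\<phi> \<in> test_functions T" for \<phi>
    using ac_self_integrable[OF ac_test_function[OF that]] .
  have "AE t in leb T. r t - c = 0"
  proof (rule AE_zero_if_test_integrals_zero)
    show "(\<lambda>t. r t - c) \<in> L1_loc T" using r by (intro integrable_imp_L1_loc) auto
    fix \<phi> assume \<phi>: "\<phi> \<in> test_functions T"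
    \<comment> \<open>Chosen so that \<open>\<phi> - k \<phi>0\<close> has mean zero and hence is
      the derivative of a test function.\<close>
    define k where "k = (LINT t|leb T. \<phi> t) / m"
    let ?\<phi> = "\<lambda>t. \<phi> t + (- k) * \<phi>0 t"
    have t: "?\<phi> \<in> test_functions T"
    proof -
      from \<phi> obtain a b where ab: "0 < a" "b < T" "\<And>x. x \<notin> {a..b} \<Longrightarrow> \<phi> x = 0" and s: "smooth \<phi>"
        unfolding test_functions_iff by blast
      from \<phi>0 obtain a0 b0 where ab0: "0 < a0" "b0 < T" "\<And>x. x \<notin> {a0..b0} \<Longrightarrow> \<phi>0 x = 0" and s0: "smooth \<phi>0"
        unfolding test_functions_iff by blast
      have "smooth ?\<phi>" using s s0 by (intro smooth_add smooth_mult smooth_const)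
      moreover have "?\<phi> x = 0" if "x \<notin> {min a a0..max b b0}" for x
      proof -
        have "x \<notin> {a..b}" "x \<notin> {a0..b0}" using that by auto
        then show ?thesis using ab(3) ab0(3) by simp
      qed
      moreover have "0 < min a a0" "max b b0 < T" using ab ab0 by auto
      ultimately show ?thesis unfolding test_functions_iff by blast
    qed
    have "(LINT t|leb T. ?\<phi> t) = (LINT t|leb T. \<phi> t) + (LINT t|leb T. (- k) * \<phi>0 t)"
      using iphi[OF \<phi>] iphi[OF \<phi>0] by (intro Bochner_Integration.integral_add) auto
    then have "(LINT t|leb T. ?\<phi> t) = 0"
      using nz by (simp add: k_def m_def)
    from test_function_antiderivative[OF t this T] obtain \<psi> where "\<psi> \<in> test_functions T" "deriv \<psi> = ?\<phi>" by auto
    with rd have "(LINT t|leb T. r t * ?\<phi> t) = 0" by metis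
    moreover have i: "integrable (leb T) (\<lambda>t. r t * \<phi> t)" "integrable (leb T) (\<lambda>t. r t * \<phi>0 t)"
      using r \<phi> \<phi>0 by (auto intro: L1_loc_test_integrable integrable_imp_L1_loc)
    moreover have "(LINT t|leb T. r t * ?\<phi> t) = (LINT t|leb T. r t * \<phi> t - k * (r t * \<phi>0 t))"
      by (rule Bochner_Integration.integral_cong) (auto simp: algebra_simps)
    ultimately have "(LINT t|leb T. r t * \<phi> t) = k * (LINT t|leb T. r t * \<phi>0 t)" by simp
    also have "\<dots> = c * (LINT t|leb T. \<phi> t)" by (simp add: k_def c_def)
    finally show "(LINT t|leb T. (r t - c) * \<phi> t) = 0"
      using i iphi[OF \<phi>] by (simp add: left_diff_distrib)
  qed
  then have "AE t in leb T. u t = c + prim T v t"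
    by eventually_elim (simp add: r_def)
  with ac_prim[OF v, of c] show ?thesis by (intro exI[of _ "\<lambda>t. c + prim T v t"]) auto
qed

text \<open>The points of the open interval where \<open>g\<close> and \<open>h\<close> differ form
  an open null set, which must be empty; continuity covers the end points. Point values of a class
  are well defined for this reason.\<close>

lemma continuous_AE_eq:
  assumes T: "0 < T" and g: "continuous_on {0..T} g" and h: "continuous_on {0..T} h"
    and ae: "AE s in leb T. g s = h s" and t: "t \<in> {0..T}"
  shows "g t = (h t :: real)"
proof -
  let ?d = "\<lambda>s. g s - h s"
  have d: "continuous_on {0..T} ?d" using g h by (intro continuous_intros)
  let ?S = "{0<..<T} \<inter> ?d -` (- {0})"
  have "open ?S"
    by (rule continuous_open_preimage) (auto intro: continuous_on_subset[OF d])
  moreover have "negligible ?S"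
  proof -
    have "AE s in lebesgue. s \<notin> ?S"
      using ae unfolding AE_leb_iff by eventually_elim auto
    then show ?thesis
      by (simp add: negligible_iff_null_sets completion.null_sets_iff_AE)
  qed
  ultimately have "?S = {}" using open_not_negligible by blast
  then have z: "?d s = 0" if "s \<in> {0<..<T}" for s using that by blast
  have cl: "closure {0<..<T} = {0..T}" using T by (rule closure_greaterThanLessThan)
  have "?d t = 0"
    by (rule continuous_constant_on_closure[of "{0<..<T}" ?d]) (use d t z cl in auto)
  then show ?thesis by simp
qed

lemma point_val_eq:
  assumes T: "0 < T" and g: "continuous_on {0..T} g" and ae: "AE s in leb T. u s = g s" and t: "t \<in> {0..T}"
  shows "point_val T u t = g t"
  unfolding point_val_def
proof (rule the_equality)
  show "\<exists>h. continuous_on {0..T} h \<and> (AE s in leb T. u s = h s) \<and> h t = g t"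
    using g ae by blast
  fix c assume "\<exists>h. continuous_on {0..T} h \<and> (AE s in leb T. u s = h s) \<and> h t = c"
  then obtain h where h: "continuous_on {0..T} h" "AE s in leb T. u s = h s" "h t = c" by auto
  have "AE s in leb T. h s = g s" using ae h(2) by eventually_elim simp
  from continuous_AE_eq[OF T h(1) g this t] show "c = g t" using h by simp
qed

section \<open>Square-integrable functions and the space of trial functions\<close>

lemma L2_iff: "f \<in> L2 T \<longleftrightarrow> f \<in> borel_measurable (leb T) \<and> integrable (leb T) (\<lambda>t. (f t)\<^sup>2)"
  by (simp add: L2_def)

lemma L2_measurable: "f \<in> L2 T \<Longrightarrow> f \<in> borel_measurable (leb T)"
  by (simp add: L2_iff)

lemma L2_mult_integrable:
  assumes "f \<in> L2 T" "g \<in> L2 T"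
  shows "integrable (leb T) (\<lambda>t. f t * g t)"
proof (rule Bochner_Integration.integrable_bound)
  show "integrable (leb T) (\<lambda>t. (f t)\<^sup>2 + (g t)\<^sup>2)"
    using assms by (auto simp: L2_iff)
  show "(\<lambda>t. f t * g t) \<in> borel_measurable (leb T)"
    using assms by (auto simp: L2_iff)
  show "AE t in leb T. norm (f t * g t) \<le> norm ((f t)\<^sup>2 + (g t)\<^sup>2)"
  proof (rule AE_I2)
    fix t
    have "0 \<le> (\<bar>f t\<bar> - \<bar>g t\<bar>)\<^sup>2" by simp
    then have "2 * (\<bar>f t\<bar> * \<bar>g t\<bar>) \<le> (f t)\<^sup>2 + (g t)\<^sup>2" by (simp add: power2_diff)
    moreover have "0 \<le> \<bar>f t\<bar> * \<bar>g t\<bar>" by simp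
    ultimately show "norm (f t * g t) \<le> norm ((f t)\<^sup>2 + (g t)\<^sup>2)"
      unfolding real_norm_def abs_mult by linarith
  qed
qed

lemma L2_const: "(\<lambda>t. c) \<in> L2 T"
  by (simp add: L2_iff)

lemma L2_integrable: "f \<in> L2 T \<Longrightarrow> integrable (leb T) f"
  using L2_mult_integrable[OF _ L2_const, of f T 1] by simp

lemma L2_add:
  assumes f: "f \<in> L2 T" and g: "g \<in> L2 T"
  shows "(\<lambda>t. f t + g t) \<in> L2 T"
proof -
  have "integrable (leb T) (\<lambda>t. f t * f t + g t * g t + (f t * g t + f t * g t))"
    by (intro Bochner_Integration.integrable_add L2_mult_integrable f g)
  then show ?thesis
    using f g by (auto simp: L2_iff power2_eq_square algebra_simps)
qed

lemma L2_cmult: "f \<in> L2 T \<Longrightarrow> (\<lambda>t. c * f t) \<in> L2 T"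
  by (auto simp: L2_iff power_mult_distrib)

lemma L2_diff:
  assumes f: "f \<in> L2 T" and g: "g \<in> L2 T"
  shows "(\<lambda>t. f t - g t) \<in> L2 T"
  using L2_add[OF f L2_cmult[OF g, of "-1"]] by simp

lemma L2_AE:
  assumes f: "f \<in> L2 T" and ae: "AE t in leb T. f t = g t"
  shows "g \<in> L2 T"
proof -
  have "AE t in leb T. (f t)\<^sup>2 = (g t)\<^sup>2" using ae by eventually_elim simp
  then show ?thesis
    using f borel_measurable_leb_AE[OF _ ae] integrable_leb_AE[of T "\<lambda>t. (f t)\<^sup>2" "\<lambda>t. (g t)\<^sup>2"]
    unfolding L2_iff by blast
qed

lemma ac_mult_L2:
  assumes F: "ac T F f" and g: "g \<in> L2 T"
  shows "(\<lambda>t. F t * g t) \<in> L2 T"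
proof -
  have "integrable (leb T) (\<lambda>t. F t * (F t * (g t)\<^sup>2))"
    using g by (intro ac_mult_integrable(1)[OF F]) (simp add: L2_iff)
  moreover have "(\<lambda>t. F t * (F t * (g t)\<^sup>2)) = (\<lambda>t. (F t * g t)\<^sup>2)"
    by (simp add: power2_eq_square mult.assoc mult.left_commute)
  ultimately show ?thesis
    using borel_measurable_times[OF ac_measurable[OF F] L2_measurable[OF g]] by (simp add: L2_iff)
qed

lemma ac_L2: "ac T F f \<Longrightarrow> F \<in> L2 T"
  using ac_mult_L2[OF _ L2_const, of T F f 1] by simp

section \<open>Norm and inner product of square-integrable functions\<close>

lemma L2_norm_nonneg: "0 \<le> L2_norm T f"
  by (simp add: L2_norm_def)

lemma L2_norm_squared: "(L2_norm T f)\<^sup>2 = (LINT t|leb T. (f t)\<^sup>2)"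
  by (simp add: L2_norm_def)

lemma L2_norm_AE:
  assumes "AE t in leb T. f t = g t"
  shows "L2_norm T f = L2_norm T g"
proof -
  have "AE t in leb T. (f t)\<^sup>2 = (g t)\<^sup>2" using assms by eventually_elim simp
  from integral_leb_AE[OF this] show ?thesis by (simp add: L2_norm_def)
qed

lemma L2_norm_cmult: "L2_norm T (\<lambda>t. c * f t) = \<bar>c\<bar> * L2_norm T f"
  by (simp add: L2_norm_def power_mult_distrib real_sqrt_mult)

lemma L2_norm_mono:
  assumes "f \<in> L2 T" "g \<in> L2 T" "\<And>t. 0 < t \<Longrightarrow> t < T \<Longrightarrow> \<bar>f t\<bar> \<le> \<bar>g t\<bar>"
  shows "L2_norm T f \<le> L2_norm T g"
  unfolding L2_norm_def
  using assms by (intro real_sqrt_le_mono integral_mono) (auto simp: L2_iff abs_le_square_iff)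

lemma L2_norm_const: "0 < T \<Longrightarrow> L2_norm T (\<lambda>t. c) = sqrt T * \<bar>c\<bar>"
  by (simp add: L2_norm_def measure_restrict_space real_sqrt_mult)

lemma L2_inner_AE:
  assumes "AE t in leb T. f t = f' t" "AE t in leb T. g t = g' t"
  shows "L2_inner T f g = L2_inner T f' g'"
  unfolding L2_inner_def by (rule integral_leb_AE) (use assms in eventually_elim, simp)

lemma L2_inner_Cauchy_Schwarz:
  assumes f: "f \<in> L2 T" and g: "g \<in> L2 T"
  shows "\<bar>L2_inner T f g\<bar> \<le> L2_norm T f * L2_norm T g"
proof -
  let ?A = "LINT t|leb T. (f t)\<^sup>2" and ?B = "LINT t|leb T. (g t)\<^sup>2" and ?C = "L2_inner T f g"
  have if2: "integrable (leb T) (\<lambda>t. (f t)\<^sup>2)" and ig2: "integrable (leb T) (\<lambda>t. (g t)\<^sup>2)"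
    using f g by (auto simp: L2_iff)
  have ifg: "integrable (leb T) (\<lambda>t. f t * g t)" using L2_mult_integrable[OF f g] .
  have q: "0 \<le> x\<^sup>2 * ?A + 2 * x * y * ?C + y\<^sup>2 * ?B" for x y
  proof -
    have "0 \<le> (LINT t|leb T. (x * f t + y * g t)\<^sup>2)" by simp
    also have "\<dots> = (LINT t|leb T. x\<^sup>2 * (f t)\<^sup>2 + 2 * x * y * (f t * g t) + y\<^sup>2 * (g t)\<^sup>2)"
      by (rule Bochner_Integration.integral_cong) (auto simp: power2_eq_square algebra_simps)
    also have "\<dots> = x\<^sup>2 * ?A + 2 * x * y * ?C + y\<^sup>2 * ?B"
      using if2 ig2 ifg by (simp add: L2_inner_def)
    finally show ?thesis .
  qed
  have B0: "0 \<le> ?B" by simp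
  have "?C\<^sup>2 \<le> ?A * ?B"
  proof (cases "?B = 0")
    case True
    have "?C = 0"
    proof (rule ccontr)
      assume "?C \<noteq> 0"
      \<comment> \<open>With \<open>?B = 0\<close> the quadratic form at \<open>x = 1\<close> is
        affine in \<open>y\<close>, and this \<open>y\<close> gives it the value -1.\<close>
      then show False
        using q[of 1 "- (?A + 1) / (2 * ?C)"] True by (simp add: field_simps)
    qed
    then show ?thesis using True by simp
  next
    case False
    then have B: "0 < ?B" using B0 by linarith
    \<comment> \<open>The choice \<open>x = ?B\<close>, \<open>y = - ?C\<close> is, up to scaling,
      the minimiser of the quadratic form.\<close>
    have "0 \<le> ?B * (?A * ?B - ?C\<^sup>2)"
      using q[of "?B" "- ?C"] by (simp add: power2_eq_square algebra_simps)
    then show ?thesis using B by (simp add: zero_le_mult_iff)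
  qed
  then have "\<bar>?C\<bar> \<le> sqrt (?A * ?B)" by (simp add: real_le_rsqrt)
  then show ?thesis by (simp add: L2_norm_def real_sqrt_mult)
qed

lemma L2_norm_triangle:
  assumes f: "f \<in> L2 T" and g: "g \<in> L2 T"
  shows "L2_norm T (\<lambda>t. f t + g t) \<le> L2_norm T f + L2_norm T g"
proof (rule power2_le_imp_le)
  have "(L2_norm T (\<lambda>t. f t + g t))\<^sup>2 = (LINT t|leb T. (f t)\<^sup>2 + 2 * (f t * g t) + (g t)\<^sup>2)"
    unfolding L2_norm_squared by (rule Bochner_Integration.integral_cong) (auto simp: power2_eq_square algebra_simps)
  also have "\<dots> = (L2_norm T f)\<^sup>2 + 2 * L2_inner T f g + (L2_norm T g)\<^sup>2"
    using f g L2_mult_integrable[OF f g] by (simp add: L2_norm_squared L2_inner_def L2_iff)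
  also have "\<dots> \<le> (L2_norm T f + L2_norm T g)\<^sup>2"
    using L2_inner_Cauchy_Schwarz[OF f g] by (simp add: power2_sum)
  finally show "(L2_norm T (\<lambda>t. f t + g t))\<^sup>2 \<le> (L2_norm T f + L2_norm T g)\<^sup>2" .
qed (simp add: L2_norm_nonneg)

lemma L2_norm_triangle_diff:
  assumes f: "f \<in> L2 T" and g: "g \<in> L2 T"
  shows "L2_norm T (\<lambda>t. f t - g t) \<le> L2_norm T f + L2_norm T g"
  using L2_norm_triangle[OF f L2_cmult[OF g, of "-1"]] L2_norm_cmult[of T "-1" g] by simp

section \<open>Control of a function by its derivative\<close>

lemma integral_abs_le_L2_norm:
  assumes T: "0 < T" and f: "f \<in> L2 T"
  shows "(LINT t|leb T. \<bar>f t\<bar>) \<le> sqrt T * L2_norm T f"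
proof -
  have a: "(\<lambda>t. \<bar>f t\<bar>) \<in> L2 T" using f by (auto simp: L2_iff)
  have n: "L2_norm T (\<lambda>t. \<bar>f t\<bar>) = L2_norm T f" by (simp add: L2_norm_def)
  show ?thesis
    using L2_inner_Cauchy_Schwarz[OF a L2_const[of 1]] T
    by (simp add: L2_inner_def L2_norm_const n mult.commute)
qed

lemma abs_ac_le:
  assumes T: "0 < T" and F: "ac T F f" and f: "f \<in> L2 T" and t: "0 \<le> t" "t \<le> T"
  shows "\<bar>F t - F 0\<bar> \<le> sqrt T * L2_norm T f"
  using abs_prim_le[OF ac_integrable[OF F], of t] integral_abs_le_L2_norm[OF T f] prim_ac[OF F t] by simp

text \<open>A Poincare inequality: one factor \<open>sqrt T\<close> comes from the pointwise bound,
  the other from the norm of a constant.\<close>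

lemma L2_norm_ac_le:
  assumes T: "0 < T" and F: "ac T F f" and f: "f \<in> L2 T" and F0: "F 0 = 0"
  shows "L2_norm T F \<le> T * L2_norm T f"
proof -
  have "L2_norm T F \<le> L2_norm T (\<lambda>t. sqrt T * L2_norm T f)"
    using abs_ac_le[OF T F f] F0 ac_L2[OF F] T
    by (intro L2_norm_mono L2_const) (auto simp: abs_mult L2_norm_nonneg)
  also have "\<dots> = T * L2_norm T f"
    using T by (simp add: L2_norm_const abs_mult L2_norm_nonneg flip: mult.assoc)
  finally show ?thesis .
qed

text \<open>A trace inequality: the constant \<open>F 0\<close> is \<open>F - (F - F 0)\<close>,
  where the Poincare inequality applies to the bracket, and its norm is
  \<open>sqrt T * \<bar>F 0\<bar>\<close>.\<close>

lemma ac_initial_value_le: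
  assumes T: "0 < T" and F: "ac T F f" and f: "f \<in> L2 T"
  shows "\<bar>F 0\<bar> \<le> (L2_norm T F + T * L2_norm T f) / sqrt T"
proof -
  have G: "ac T (\<lambda>t. F t - F 0) f" using ac_diff[OF F ac_const[of T "F 0"]] by simp
  have "L2_norm T (\<lambda>t. F 0) = L2_norm T (\<lambda>t. F t - (F t - F 0))" by simp
  also have "\<dots> \<le> L2_norm T F + L2_norm T (\<lambda>t. F t - F 0)"
    by (intro L2_norm_triangle_diff ac_L2[OF F] ac_L2[OF G])
  also have "\<dots> \<le> L2_norm T F + T * L2_norm T f"
    using L2_norm_ac_le[OF T G f] by simp
  finally show ?thesis using T by (simp add: L2_norm_const field_simps)
qed

text \<open>
  \<open>h20_rep T w W D g\<close>: the class of \<open>w\<close> has the \<open>C\<^sup>1\<close> representative \<open>W\<close> with \<open>W(0) = 0\<close>,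
  \<open>W' = D\<close> and \<open>D' = g\<close>.
\<close>

definition h20_rep ::
    "real \<Rightarrow> (real \<Rightarrow> real) \<Rightarrow> (real \<Rightarrow> real) \<Rightarrow> (real \<Rightarrow> real) \<Rightarrow> (real \<Rightarrow> real) \<Rightarrow> bool" where
  "h20_rep T w W D g \<longleftrightarrow>
     (AE t in leb T. w t = W t) \<and> ac T W D \<and> ac T D g \<and> g \<in> L2 T \<and> W 0 = 0"

context
  fixes T :: real and w W D g
  assumes T: "0 < T" and rep: "h20_rep T w W D g"
begin

lemma h20_rep_props:
  shows "AE t in leb T. w t = W t" "ac T W D" "ac T D g" "g \<in> L2 T" "W 0 = 0"
  using rep by (auto simp: h20_rep_def)

lemma h20_rep_weak_deriv: "weak_deriv T 0 w w" "weak_deriv T 1 w D" "weak_deriv T 2 w g"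
proof -
  note r = h20_rep_props
  have "AE t in leb T. W t = w t" using r(1) by eventually_elim simp
  then have "w \<in> L1_loc T" using L1_loc_AE integrable_imp_L1_loc[OF ac_self_integrable[OF r(2)]] by blast
  then show "weak_deriv T 0 w w" by (rule weak_deriv_0)
  have D: "weak_deriv T 0 D D"
    using ac_self_integrable[OF r(3)] by (intro weak_deriv_0 integrable_imp_L1_loc)
  show "weak_deriv T 1 w D" using weak_deriv_Suc[OF r(1,2) D T] by simp
  have "weak_deriv T 0 g g"
    using L2_integrable[OF r(4)] by (intro weak_deriv_0 integrable_imp_L1_loc)
  then have "weak_deriv T 1 D g" using weak_deriv_Suc[OF _ r(3) _ T, of D 0] by simp
  then show "weak_deriv T 2 w g" using weak_deriv_Suc[OF r(1,2) _ T] by (simp add: numeral_2_eq_2)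
qed

lemma h20_rep_wD:
  shows "AE t in leb T. wD T 0 w t = W t"
    and "AE t in leb T. wD T 1 w t = D t"
    and "AE t in leb T. wD T 2 w t = g t"
proof -
  show "AE t in leb T. wD T 0 w t = W t"
    using AE_wD[OF h20_rep_weak_deriv(1)] h20_rep_props(1) by eventually_elim simp
qed (intro AE_wD h20_rep_weak_deriv)+

lemma h20_rep_L2: "w \<in> L2 T"
proof -
  have "AE t in leb T. W t = w t" using h20_rep_props(1) by eventually_elim simp
  then show ?thesis using L2_AE ac_L2[OF h20_rep_props(2)] by blast
qed

lemma h20_rep_H20: "w \<in> H20 T"
proof -
  have "\<exists>v\<in>L2 T. weak_deriv T j w v" if "j \<le> 2" for j
  proof -
    consider "j = 0" | "j = 1" | "j = 2" using \<open>j \<le> 2\<close> by linarith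
    then show ?thesis
      using h20_rep_weak_deriv h20_rep_L2 ac_L2[OF h20_rep_props(3)] h20_rep_props(4) by cases auto
  qed
  moreover have "point_val T w 0 = 0"
    using point_val_eq[OF T ac_continuous_on[OF h20_rep_props(2)] h20_rep_props(1), of 0] T h20_rep_props(5) by simp
  ultimately show ?thesis using h20_rep_L2 by (simp add: H20_def H_space_def)
qed

lemma h20_rep_point_val: "point_val T (wD T 1 w) 0 = D 0"
  using point_val_eq[OF T ac_continuous_on[OF h20_rep_props(3)] h20_rep_wD(2), of 0] T by simp

end

text \<open>Testing with derivatives of test functions shows that the second weak derivative is a
  weak derivative of the first. The argument of du Bois-Reymond then applies twice, to the
  derivative and to the function.\<close>

lemma H20_obtains_rep:
  assumes T: "0 < T" and w: "w \<in> H20 T"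
  obtains W D g where "h20_rep T w W D g"
proof -
  from w have H: "w \<in> L2 T" "\<And>j. j \<le> 2 \<Longrightarrow> \<exists>v\<in>L2 T. weak_deriv T j w v" "point_val T w 0 = 0"
    by (auto simp: H20_def H_space_def)
  obtain v where v: "v \<in> L2 T" "weak_deriv T 1 w v" using H(2)[of 1] by auto
  obtain g where g: "g \<in> L2 T" "weak_deriv T 2 w g" using H(2)[of 2] by auto
  have "weak_deriv T 1 v g"
    unfolding weak_deriv_def
  proof (intro conjI ballI)
    show "v \<in> L1_loc T" "g \<in> L1_loc T"
      using weak_derivD(2)[OF v(2)] weak_derivD(2)[OF g(2)] by auto
    fix \<phi> assume \<phi>: "\<phi> \<in> test_functions T"
    have "(LINT t|leb T. v t * deriv \<phi> t) = - (LINT t|leb T. w t * deriv (deriv \<phi>) t)"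
      using weak_derivD(3)[OF v(2) test_function_deriv[OF \<phi>]] by simp
    also have "\<dots> = - (LINT t|leb T. g t * \<phi> t)"
      using weak_derivD(3)[OF g(2) \<phi>] by (simp add: numeral_2_eq_2)
    finally show "(LINT t|leb T. v t * (deriv ^^ 1) \<phi> t) = (- 1) ^ 1 * (LINT t|leb T. g t * \<phi> t)"
      by simp
  qed
  from weak_deriv_imp_ac[OF this L2_integrable[OF v(1)] L2_integrable[OF g(1)] T]
  obtain D where D: "AE t in leb T. v t = D t" "ac T D g" by auto
  from weak_deriv_imp_ac[OF v(2) L2_integrable[OF H(1)] L2_integrable[OF v(1)] T]
  obtain W where W: "AE t in leb T. w t = W t" "ac T W v" by auto
  have "AE t in leb T. D t = v t" using D(1) by eventually_elim simp
  then have "ac T W D" using ac_cong[OF W(2)] by blast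
  moreover have "W 0 = 0"
    using point_val_eq[OF T ac_continuous_on[OF W(2)] W(1), of 0] T H(3) by simp
  ultimately show thesis using that D W g by (auto simp: h20_rep_def)
qed

lemma h20_rep_diff:
  assumes "h20_rep T u U D g" "h20_rep T v V E k"
  shows "h20_rep T (\<lambda>t. u t - v t) (\<lambda>t. U t - V t) (\<lambda>t. D t - E t) (\<lambda>t. g t - k t)"
proof -
  have "AE t in leb T. u t = U t" "AE t in leb T. v t = V t"
    using assms by (auto simp: h20_rep_def)
  then have "AE t in leb T. u t - v t = U t - V t" by eventually_elim simp
  then show ?thesis using assms by (auto simp: h20_rep_def intro: ac_diff L2_diff)
qed

lemma h20_rep_cmult:
  assumes "h20_rep T u U D g"
  shows "h20_rep T (\<lambda>t. c * u t) (\<lambda>t. c * U t) (\<lambda>t. c * D t) (\<lambda>t. c * g t)"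
  using assms unfolding h20_rep_def
  by (auto intro: ac_cmult L2_cmult)

section \<open>The exponential weight and the transformed test functions\<close>

definition weight :: "real \<Rightarrow> real \<Rightarrow> real" where
  "weight T t = exp (- t / T)"

lemma ac_weight:
  assumes "0 < T"
  shows "ac T (weight T) (\<lambda>t. - (1 / T) * weight T t)"
proof (rule ac_C1)
  show "(weight T has_real_derivative - (1 / T) * weight T t) (at t)" for t
    unfolding weight_def using assms by (auto intro!: derivative_eq_intros)
  show "continuous_on UNIV (\<lambda>t. - (1 / T) * weight T t)"
    unfolding weight_def using assms by (auto intro!: continuous_intros)
qed

lemma weight_bounds: "0 < T \<Longrightarrow> 0 \<le> t \<Longrightarrow> t \<le> T \<Longrightarrow> exp (-1) \<le> weight T t \<and> weight T t \<le> 1"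
  by (simp add: weight_def)

lemma set_integral_eq_prim:
  assumes f: "f \<in> borel_measurable (leb T)" and t: "0 \<le> t" "t < T"
  shows "(LINT s:{0..t}|lebesgue. f s) = prim T f t"
proof -
  let ?k = "\<lambda>s. indicator {0<..<T} s *\<^sub>R (indicator {..t} s * f s)"
  let ?l = "\<lambda>s. indicator {0..t} s *\<^sub>R f s"
  have m: "?k \<in> borel_measurable lebesgue"
  proof -
    have "(\<lambda>s. if s \<in> {0<..<T} then indicator {..t} s * f s else 0) \<in> borel_measurable lebesgue"
      using f by (intro borel_measurable_if_I) auto
    also have "(\<lambda>s. if s \<in> {0<..<T} then indicator {..t} s * f s else 0) = ?k" by auto
    finally show ?thesis .
  qed
  have ae: "AE s in lebesgue. ?k s = ?l s"
  proof -
    have "{0} \<in> null_sets (lebesgue :: real measure)" using null_sets_completionI by fastforce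
    from AE_not_in[OF this] show ?thesis
      by eventually_elim (use t in \<open>auto simp: indicator_def\<close>)
  qed
  have "prim T f t = (LINT s|lebesgue. ?k s)"
    unfolding prim_def by (rule integral_restrict_space) auto
  also have "\<dots> = (LINT s|lebesgue. ?l s)"
    by (rule integral_cong_AE[OF m borel_measurable_AE[OF m ae] ae])
  finally show ?thesis by (simp add: set_lebesgue_integral_def)
qed

text \<open>The derivative of the transformed function is the weight times \<open>D\<close>, again
  absolutely continuous by the product rule. Hence transformed discrete functions are admissible in
  the continuous problem.\<close>

lemma h20_rep_L_op:
  assumes T: "0 < T" and rep: "h20_rep T w W D g"
  shows "h20_rep T (L_op T w) (prim T (\<lambda>t. weight T t * D t)) (\<lambda>t. weight T t * D t)
    (\<lambda>t. - (1 / T) * weight T t * D t + weight T t * g t)"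
  unfolding h20_rep_def
proof (intro conjI)
  note r = h20_rep_props[OF T rep] and wd = h20_rep_wD(2)[OF T rep]
  show wD: "ac T (\<lambda>t. weight T t * D t) (\<lambda>t. - (1 / T) * weight T t * D t + weight T t * g t)"
    using ac_mult[OF ac_weight[OF T] r(3)] by simp
  show "(\<lambda>t. - (1 / T) * weight T t * D t + weight T t * g t) \<in> L2 T"
    using L2_add[OF L2_cmult[OF ac_L2[OF wD], of "- (1 / T)"] ac_mult_L2[OF ac_weight[OF T] r(4)]]
    by (simp add: mult.assoc)
  show "ac T (prim T (\<lambda>t. weight T t * D t)) (\<lambda>t. weight T t * D t)"
    using ac_prim[OF ac_self_integrable[OF wD], of 0] by simp
  show "prim T (\<lambda>t. weight T t * D t) 0 = 0" by (simp add: prim_0)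
  show "AE t in leb T. L_op T w t = prim T (\<lambda>t. weight T t * D t) t"
  proof (rule AE_leb_I)
    fix t assume t: "0 < t" "t < T"
    have ae: "AE s in leb T. weight T s * D s = exp (- s / T) * wD T 1 w s"
      using wd by eventually_elim (simp add: weight_def)
    have ae': "AE s in leb T. exp (- s / T) * wD T 1 w s = weight T s * D s"
      using wd by eventually_elim (simp add: weight_def)
    have "L_op T w t = prim T (\<lambda>s. exp (- s / T) * wD T 1 w s) t"
      unfolding L_op_def using t
      by (intro set_integral_eq_prim borel_measurable_leb_AE[OF ac_measurable[OF wD] ae]) auto
    also have "\<dots> = prim T (\<lambda>t. weight T t * D t) t" by (rule prim_cong_AE[OF ae'])
    finally show "L_op T w t = prim T (\<lambda>t. weight T t * D t) t" .
  qed
qed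

section \<open>The bilinear form and the dual problem\<close>

text \<open>
  \<open>bil T \<mu> V D g E\<close> is \<open>a\<^sub>\<mu>(v, \<L>\<^sub>T w)\<close> for \<open>v = V\<close> with derivatives \<open>D, g\<close> and \<open>\<partial>\<^sub>t w = E\<close>.
\<close>

definition bil where
  "bil T \<mu> V D g E = L2_inner T g (\<lambda>t. weight T t * E t) + D 0 * E 0
     + \<mu> * L2_inner T V (\<lambda>t. weight T t * E t)"

lemma a_form_L_op:
  assumes T: "0 < T" and u: "h20_rep T u V D g" and w: "h20_rep T w W E k"
  shows "a_form T \<mu> u (L_op T w) = bil T \<mu> V D g E"
proof -
  note Lw = h20_rep_L_op[OF T w]
  note uW = h20_rep_wD[OF T u] and lW = h20_rep_wD[OF T Lw]
  show ?thesis
    unfolding a_form_def bil_def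
    using L2_inner_AE[OF uW(3) lW(2)] L2_inner_AE[OF h20_rep_props(1)[OF T u] lW(2)]
      h20_rep_point_val[OF T u] h20_rep_point_val[OF T Lw]
    by (simp add: weight_def)
qed

lemma L2_inner_diff_left:
  assumes "f \<in> L2 T" "g \<in> L2 T" "k \<in> L2 T"
  shows "L2_inner T (\<lambda>t. f t - g t) k = L2_inner T f k - L2_inner T g k"
  using L2_mult_integrable[OF assms(1,3)] L2_mult_integrable[OF assms(2,3)]
  by (simp add: L2_inner_def left_diff_distrib)

lemma L2_inner_diff_right:
  assumes "f \<in> L2 T" "g \<in> L2 T" "k \<in> L2 T"
  shows "L2_inner T k (\<lambda>t. f t - g t) = L2_inner T k f - L2_inner T k g"
  using L2_mult_integrable[OF assms(3,1)] L2_mult_integrable[OF assms(3,2)]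
  by (simp add: L2_inner_def right_diff_distrib)

lemma bil_diff_left:
  assumes T: "0 < T" and E: "E \<in> L2 T"
    and u: "h20_rep T u U D g" and v: "h20_rep T v V F k"
  shows "bil T \<mu> (\<lambda>t. U t - V t) (\<lambda>t. D t - F t) (\<lambda>t. g t - k t) E = bil T \<mu> U D g E - bil T \<mu> V F k E"
proof -
  note ru = h20_rep_props[OF T u] and rv = h20_rep_props[OF T v]
  have wE: "(\<lambda>t. weight T t * E t) \<in> L2 T" using ac_mult_L2[OF ac_weight[OF T] E] .
  show ?thesis
    unfolding bil_def L2_inner_diff_left[OF ru(4) rv(4) wE]
      L2_inner_diff_left[OF ac_L2[OF ru(2)] ac_L2[OF rv(2)] wE]
    by (simp add: algebra_simps)
qed

lemma bil_diff_right:
  assumes T: "0 < T" and E: "E \<in> L2 T" and F: "F \<in> L2 T" and u: "h20_rep T u U D g"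
  shows "bil T \<mu> U D g (\<lambda>t. E t - F t) = bil T \<mu> U D g E - bil T \<mu> U D g F"
proof -
  note ru = h20_rep_props[OF T u]
  have w: "(\<lambda>t. weight T t * E t) \<in> L2 T" "(\<lambda>t. weight T t * F t) \<in> L2 T"
    using ac_mult_L2[OF ac_weight[OF T]] E F by auto
  show ?thesis
    unfolding bil_def right_diff_distrib[of "weight T _"]
      L2_inner_diff_right[OF w ru(4)] L2_inner_diff_right[OF w ac_L2[OF ru(2)]]
    by (simp add: algebra_simps)
qed

lemma bil_bound:
  assumes T: "0 < T" and \<mu>: "0 \<le> \<mu>" and E: "E \<in> L2 T" and u: "h20_rep T u U D g"
  shows "\<bar>bil T \<mu> U D g E\<bar> \<le> L2_norm T g * L2_norm T E + \<bar>D 0\<bar> * \<bar>E 0\<bar> + \<mu> * (L2_norm T U * L2_norm T E)"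
proof -
  note ru = h20_rep_props[OF T u]
  have w: "(\<lambda>t. weight T t * E t) \<in> L2 T" using ac_mult_L2[OF ac_weight[OF T] E] .
  have n: "L2_norm T (\<lambda>t. weight T t * E t) \<le> L2_norm T E"
    using weight_bounds[OF T] by (intro L2_norm_mono w E) (simp add: abs_mult mult_left_le_one_le weight_def)
  have *: "\<bar>L2_inner T f (\<lambda>t. weight T t * E t)\<bar> \<le> L2_norm T f * L2_norm T E" if "f \<in> L2 T" for f
    using L2_inner_Cauchy_Schwarz[OF that w] mult_left_mono[OF n L2_norm_nonneg[of T f]] by simp
  have "\<bar>\<mu> * L2_inner T U (\<lambda>t. weight T t * E t)\<bar> \<le> \<mu> * (L2_norm T U * L2_norm T E)"
    using *[OF ac_L2[OF ru(2)]] \<mu> by (simp add: abs_mult mult_left_mono)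
  moreover have "\<bar>D 0 * E 0\<bar> = \<bar>D 0\<bar> * \<bar>E 0\<bar>" by (simp add: abs_mult)
  ultimately show ?thesis
    unfolding bil_def using *[OF ru(4)] by linarith
qed

text \<open>The weight turns the skew part \<open>(F', F)\<close> into a multiple of the \<open>L\<^sup>2\<close> norm.\<close>

lemma weighted_parts:
  assumes T: "0 < T" and F: "ac T F f"
  shows "exp (-1) / (2 * T) * (L2_norm T F)\<^sup>2 - (F 0)\<^sup>2 / 2 \<le> (LINT t|leb T. f t * (weight T t * F t))"
proof -
  let ?w = "weight T"
  have wF: "ac T (\<lambda>t. ?w t * F t) (\<lambda>t. - (1 / T) * ?w t * F t + ?w t * f t)"
    using ac_mult[OF ac_weight[OF T] F] by simp
  let ?I = "LINT t|leb T. f t * (?w t * F t)" and ?J = "LINT t|leb T. ?w t * (F t)\<^sup>2"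
  have i1: "integrable (leb T) (\<lambda>t. ?w t * (F t)\<^sup>2)"
    using ac_L2[OF F] by (intro ac_mult_integrable[OF ac_weight[OF T]]) (simp add: L2_iff)
  have i2: "integrable (leb T) (\<lambda>t. f t * (?w t * F t))"
    by (rule ac_mult_integrable[OF wF ac_integrable[OF F]])
  have "?I = F T * (?w T * F T) - F 0 * (?w 0 * F 0)
      - (LINT t|leb T. F t * (- (1 / T) * ?w t * F t + ?w t * f t))"
    using ac_parts[OF F wF T] by simp
  also have "(LINT t|leb T. F t * (- (1 / T) * ?w t * F t + ?w t * f t))
      = (LINT t|leb T. f t * (?w t * F t) - (1 / T) * (?w t * (F t)\<^sup>2))"
    by (rule Bochner_Integration.integral_cong) (auto simp: power2_eq_square algebra_simps)
  also have "\<dots> = ?I - (1 / T) * ?J"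
    using i1 i2 by simp
  \<comment> \<open>The integral \<open>?I\<close> has reappeared with the opposite sign, so the
    identity is solved for it. The term with \<open>?J\<close> is the gain from the decay of the
    weight, whose end values are 1 and \<open>exp (-1)\<close>.\<close>
  finally have "2 * ?I = exp (-1) * (F T)\<^sup>2 - (F 0)\<^sup>2 + (1 / T) * ?J"
    using T by (simp add: weight_def power2_eq_square algebra_simps)
  moreover have "exp (-1) * (L2_norm T F)\<^sup>2 \<le> ?J"
  proof -
    have "exp (-1) * (L2_norm T F)\<^sup>2 = (LINT t|leb T. exp (-1) * (F t)\<^sup>2)"
      by (simp add: L2_norm_squared)
    also have "\<dots> \<le> ?J"
      using i1 ac_L2[OF F] weight_bounds[OF T]
      by (intro integral_mono) (auto simp: L2_iff intro!: mult_right_mono)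
    finally show ?thesis .
  qed
  then have "(1 / T) * (exp (-1) * (L2_norm T F)\<^sup>2) \<le> (1 / T) * ?J"
    using T by (intro mult_left_mono) auto
  moreover have "0 \<le> exp (-1) * (F T)\<^sup>2" by simp
  ultimately have "(1 / T) * (exp (-1) * (L2_norm T F)\<^sup>2) - (F 0)\<^sup>2 \<le> 2 * ?I" by linarith
  then show ?thesis by (simp add: field_simps)
qed

text \<open>For \<open>F = D\<close> the weighted integration by parts costs
  \<open>(D 0)\<^sup>2 / 2\<close>, which the boundary product in the form repays twice over. For
  \<open>F = U\<close> there is no such cost because \<open>U 0 = 0\<close>, and the zero-order term
  is nonnegative.\<close>

lemma bil_coercive:
  assumes T: "0 < T" and \<mu>: "0 \<le> \<mu>" and u: "h20_rep T u U D g"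
  shows "exp (-1) / (2 * T) * (L2_norm T D)\<^sup>2 + (D 0)\<^sup>2 / 2 \<le> bil T \<mu> U D g D"
proof -
  note ru = h20_rep_props[OF T u]
  have 1: "exp (-1) / (2 * T) * (L2_norm T D)\<^sup>2 - (D 0)\<^sup>2 / 2 \<le> L2_inner T g (\<lambda>t. weight T t * D t)"
    unfolding L2_inner_def by (rule weighted_parts[OF T ru(3)])
  have "0 \<le> (LINT t|leb T. D t * (weight T t * U t))"
  proof -
    have "0 \<le> exp (-1) / (2 * T) * (L2_norm T U)\<^sup>2" using T by simp
    then show ?thesis using weighted_parts[OF T ru(2)] ru(5) by simp
  qed
  also have "\<dots> = L2_inner T U (\<lambda>t. weight T t * D t)"
    unfolding L2_inner_def by (rule Bochner_Integration.integral_cong) (auto simp: algebra_simps)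
  finally have 2: "0 \<le> \<mu> * L2_inner T U (\<lambda>t. weight T t * D t)" using \<mu> by simp
  show ?thesis unfolding bil_def using 1 2 by (simp add: power2_eq_square)
qed

text \<open>
  The dual problem \<open>\<zeta>'' + \<mu> \<zeta> = e\<close>, \<open>\<zeta>(T) = \<zeta>'(T) = 0\<close>, solved by variation of constants.
\<close>

lemma dual_ode:
  assumes T: "0 < T" and \<omega>: "0 < \<omega>" and e: "e \<in> L2 T"
  obtains \<zeta> \<zeta>1 where "ac T \<zeta> \<zeta>1" "ac T \<zeta>1 (\<lambda>t. e t - \<omega>\<^sup>2 * \<zeta> t)" "\<zeta> T = 0" "\<zeta>1 T = 0"
    "L2_norm T \<zeta> \<le> 4 * T / \<omega> * L2_norm T e" "L2_norm T \<zeta>1 \<le> 4 * T * L2_norm T e"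
proof -
  define c where "c t = cos (\<omega> * t)" for t
  define s where "s t = sin (\<omega> * t)" for t
  have c: "ac T c (\<lambda>t. - \<omega> * s t)" and s: "ac T s (\<lambda>t. \<omega> * c t)"
    unfolding c_def s_def by (auto intro!: ac_C1 derivative_eq_intros continuous_intros)
  \<comment> \<open>\<open>A\<close> and \<open>B\<close> are the integrals of \<open>s e\<close>
    and \<open>c e\<close> over \<open>(t, T)\<close>, so both vanish at \<open>T\<close>.\<close>
  define A where "A t = (LINT r|leb T. s r * e r) + prim T (\<lambda>r. - 1 * (s r * e r)) t" for t
  define B where "B t = (LINT r|leb T. c r * e r) + prim T (\<lambda>r. - 1 * (c r * e r)) t" for t
  have se: "(\<lambda>r. s r * e r) \<in> L2 T" and ce: "(\<lambda>r. c r * e r) \<in> L2 T"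
    using ac_mult_L2[OF s e] ac_mult_L2[OF c e] by auto
  have A: "ac T A (\<lambda>r. - 1 * (s r * e r))" and B: "ac T B (\<lambda>r. - 1 * (c r * e r))"
    unfolding A_def B_def
    by (intro ac_prim integrable_mult_right L2_integrable se ce)+
  have AT: "A T = 0" "B T = 0" by (auto simp: A_def B_def prim_T)
  \<comment> \<open>By Cauchy-Schwarz \<open>N\<close> bounds a full integral and an indefinite one
    alike; this gives \<open>2 N\<close> for each of \<open>A\<close>, \<open>B\<close> and
    \<open>4 N\<close> for their combination.\<close>
  define N where "N = sqrt T * L2_norm T e"
  have N0: "0 \<le> N" using T by (simp add: N_def L2_norm_nonneg)
  have bnd: "\<bar>(LINT r|leb T. k r * e r) + prim T (\<lambda>r. - 1 * (k r * e r)) t\<bar> \<le> 2 * N"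
    if k: "(\<lambda>r. k r * e r) \<in> L2 T" and k1: "\<And>r. \<bar>k r\<bar> \<le> 1" for k :: "real \<Rightarrow> real" and t
  proof -
    have n: "L2_norm T (\<lambda>r. k r * e r) \<le> L2_norm T e"
      using k1 by (intro L2_norm_mono k e) (simp add: abs_mult mult_left_le_one_le)
    have *: "(LINT r|leb T. \<bar>k r * e r\<bar>) \<le> N"
      using integral_abs_le_L2_norm[OF T k] mult_left_mono[OF n, of "sqrt T"] T
      unfolding N_def by (meson order_trans real_sqrt_ge_zero less_imp_le)
    have "\<bar>LINT r|leb T. k r * e r\<bar> \<le> N"
      using integral_abs_bound[of "leb T" "\<lambda>r. k r * e r"] * by linarith
    moreover have "\<bar>prim T (\<lambda>r. - 1 * (k r * e r)) t\<bar> \<le> N"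
      using abs_prim_le[OF L2_integrable[OF k], of t] * unfolding prim_cmult by simp
    ultimately show ?thesis by linarith
  qed
  have A2: "\<bar>A t\<bar> \<le> 2 * N" for t unfolding A_def by (rule bnd[OF se]) (simp add: s_def)
  have B2: "\<bar>B t\<bar> \<le> 2 * N" for t unfolding B_def by (rule bnd[OF ce]) (simp add: c_def)
  have sc: "s t * s t + c t * c t = 1" for t
    using sin_cos_squared_add[of "\<omega> * t"] by (simp add: s_def c_def power2_eq_square)
  \<comment> \<open>By the addition theorem this is the integral of
    \<open>sin (\<omega> (r - t)) e(r) / \<omega>\<close> over \<open>r\<close> in
    \<open>(t, T)\<close>, Duhamel's formula run backwards from \<open>T\<close>.\<close>
  define \<zeta> where "\<zeta> t = (1 / \<omega>) * (c t * A t - s t * B t)" for t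
  define \<zeta>1 where "\<zeta>1 t = - 1 * (s t * A t + c t * B t)" for t
  have 1: "ac T \<zeta> \<zeta>1"
    by (rule ac_cong[OF ac_cmult[OF ac_diff[OF ac_mult[OF c A] ac_mult[OF s B]], of "1 / \<omega>"]])
       (use \<omega> in \<open>auto simp: \<zeta>_def \<zeta>1_def field_simps intro!: AE_I2\<close>)
  have 2: "ac T \<zeta>1 (\<lambda>t. e t - \<omega>\<^sup>2 * \<zeta> t)"
  proof (rule ac_cong[OF ac_cmult[OF ac_add[OF ac_mult[OF s A] ac_mult[OF c B]], of "- 1"]])
    show "AE t in leb T. e t - \<omega>\<^sup>2 * \<zeta> t = - 1 * (\<omega> * c t * A t + s t * (- 1 * (s t * e t)) + (- \<omega> * s t * B t + c t * (- 1 * (c t * e t))))"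
    proof (rule AE_I2)
      fix t
      have "e t = (s t * s t + c t * c t) * e t" by (simp add: sc)
      moreover have "\<omega>\<^sup>2 * \<zeta> t = \<omega> * (c t * A t - s t * B t)"
        using \<omega> by (simp add: \<zeta>_def power2_eq_square)
      ultimately show "e t - \<omega>\<^sup>2 * \<zeta> t = - 1 * (\<omega> * c t * A t + s t * (- 1 * (s t * e t)) + (- \<omega> * s t * B t + c t * (- 1 * (c t * e t))))"
        by (simp add: algebra_simps)
    qed
  qed (simp add: \<zeta>1_def)
  have lin: "\<bar>x * A t\<bar> + \<bar>y * B t\<bar> \<le> 4 * N" if "\<bar>x\<bar> \<le> 1" "\<bar>y\<bar> \<le> 1" for x y t
  proof -
    have "\<bar>x * A t\<bar> \<le> 1 * (2 * N)" "\<bar>y * B t\<bar> \<le> 1 * (2 * N)"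
      unfolding abs_mult using that A2 B2 by (intro mult_mono; simp)+
    then show ?thesis by linarith
  qed
  have scb: "\<bar>s t\<bar> \<le> 1" "\<bar>c t\<bar> \<le> 1" for t by (auto simp: s_def c_def)
  have TN: "sqrt T * N = T * L2_norm T e" using T by (simp add: N_def flip: mult.assoc)
  have "L2_norm T \<zeta> \<le> L2_norm T (\<lambda>t. 4 * N / \<omega>)"
  proof (intro L2_norm_mono ac_L2[OF 1] L2_const)
    fix t
    have "\<bar>c t * A t - s t * B t\<bar> \<le> 4 * N" using lin[OF scb(2) scb(1), of t t t] by linarith
    then show "\<bar>\<zeta> t\<bar> \<le> \<bar>4 * N / \<omega>\<bar>"
      using \<omega> N0 by (simp add: \<zeta>_def abs_mult divide_right_mono)
  qed
  also have "\<dots> = 4 * T / \<omega> * L2_norm T e"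
    using T \<omega> N0 TN by (simp add: L2_norm_const field_simps)
  finally have 3: "L2_norm T \<zeta> \<le> 4 * T / \<omega> * L2_norm T e" .
  have "L2_norm T \<zeta>1 \<le> L2_norm T (\<lambda>t. 4 * N)"
  proof (intro L2_norm_mono ac_L2[OF 2] L2_const)
    fix t
    have "\<bar>s t * A t + c t * B t\<bar> \<le> 4 * N" using lin[OF scb(1) scb(2), of t t t] by linarith
    then show "\<bar>\<zeta>1 t\<bar> \<le> \<bar>4 * N\<bar>"
      using N0 unfolding \<zeta>1_def abs_mult by simp
  qed
  also have "\<dots> = 4 * T * L2_norm T e"
    using T N0 TN by (simp add: L2_norm_const field_simps)
  finally have 4: "L2_norm T \<zeta>1 \<le> 4 * T * L2_norm T e" .
  show thesis by (rule that[OF 1 2 _ _ 3 4]) (auto simp: \<zeta>_def \<zeta>1_def AT)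
qed

text \<open>The factor \<open>exp 1\<close> bounds \<open>exp (t / T)\<close>. In the bracket,
  \<open>\<zeta> / T\<^sup>2\<close> contributes the first summand, \<open>2 \<zeta>' / T\<close>
  and \<open>e\<close> contribute 8 + 1, and \<open>\<mu> \<zeta>\<close> the last.\<close>

definition dual_const where
  "dual_const T \<mu> = exp 1 * (4 / (T * sqrt \<mu>) + 9 + 4 * T * sqrt \<mu>)"

text \<open>The factor \<open>exp (t / T)\<close> in \<open>z\<close> cancels the weight. Two
  integrations by parts then move both derivatives onto \<open>\<zeta>\<close>: the terms at
  \<open>T\<close> vanish by the terminal conditions, one term at 0 because \<open>V 0 = 0\<close>,
  and the remaining \<open>- D 0 * \<zeta> 0\<close> cancels the boundary product of the
  form.\<close>

lemma dual_problem:
  assumes T: "0 < T" and \<mu>: "0 < \<mu>" and e: "e \<in> L2 T"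
  obtains Z z z1 z2 where "h20_rep T Z Z z z1" "ac T z1 z2" "z2 \<in> L2 T"
    "L2_norm T z2 \<le> dual_const T \<mu> * L2_norm T e"
    "\<And>v V D g. h20_rep T v V D g \<Longrightarrow> bil T \<mu> V D g z = L2_inner T V e"
proof -
  define \<omega> where "\<omega> = sqrt \<mu>"
  have \<omega>: "0 < \<omega>" "\<omega>\<^sup>2 = \<mu>" using \<mu> by (auto simp: \<omega>_def)
  obtain \<zeta> \<zeta>1 where 1: "ac T \<zeta> \<zeta>1" and 2: "ac T \<zeta>1 (\<lambda>t. e t - \<omega>\<^sup>2 * \<zeta> t)" and end_values: "\<zeta> T = 0" "\<zeta>1 T = 0"
    and b: "L2_norm T \<zeta> \<le> 4 * T / \<omega> * L2_norm T e" "L2_norm T \<zeta>1 \<le> 4 * T * L2_norm T e"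
    using dual_ode[OF T \<omega>(1) e] by blast
  define q where "q t = exp (t / T)" for t
  have q: "ac T q (\<lambda>t. (1 / T) * q t)"
    unfolding q_def using T by (auto intro!: ac_C1 derivative_eq_intros continuous_intros)
  define z where "z t = q t * \<zeta> t" for t
  define z1 where "z1 t = q t * ((1 / T) * \<zeta> t + \<zeta>1 t)" for t
  \<comment> \<open>The second derivative of \<open>q \<zeta>\<close> divided by \<open>q\<close>,
    with \<open>\<zeta>''\<close> eliminated through the differential equation.\<close>
  define y where "y t = ((1 / T\<^sup>2) * \<zeta> t + (2 / T) * \<zeta>1 t) + (e t - \<omega>\<^sup>2 * \<zeta> t)" for t
  define z2 where "z2 t = q t * y t" for t
  have z: "ac T z z1"
    by (rule ac_cong[OF ac_mult[OF q 1]]) (auto simp: z_def z1_def algebra_simps intro!: AE_I2)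
  have z1: "ac T z1 z2"
    by (rule ac_cong[OF ac_mult[OF q ac_add[OF ac_cmult[OF 1, of "1 / T"] 2]]])
       (auto simp: z1_def z2_def y_def algebra_simps power2_eq_square add_divide_distrib intro!: AE_I2)
  have L: "\<zeta> \<in> L2 T" "\<zeta>1 \<in> L2 T" using ac_L2[OF 1] ac_L2[OF 2] .
  have y: "y \<in> L2 T" unfolding y_def by (intro L2_add L2_diff L2_cmult L e)
  have z2: "z2 \<in> L2 T" unfolding z2_def by (rule ac_mult_L2[OF q y])
  have Z: "h20_rep T (prim T z) (prim T z) z z1"
    using ac_prim[OF ac_self_integrable[OF z], of 0] z ac_L2[OF z1]
    by (auto simp: h20_rep_def prim_0)
  have "L2_norm T y \<le> (L2_norm T (\<lambda>t. (1 / T\<^sup>2) * \<zeta> t) + L2_norm T (\<lambda>t. (2 / T) * \<zeta>1 t)) + (L2_norm T e + L2_norm T (\<lambda>t. \<omega>\<^sup>2 * \<zeta> t))"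
    unfolding y_def
    by (rule order_trans[OF L2_norm_triangle] add_mono L2_norm_triangle L2_norm_triangle_diff
        L2_add L2_diff L2_cmult L e)+
  also have "\<dots> = 1 / T\<^sup>2 * L2_norm T \<zeta> + 2 / T * L2_norm T \<zeta>1 + (L2_norm T e + \<omega>\<^sup>2 * L2_norm T \<zeta>)"
    using T by (simp add: L2_norm_cmult abs_mult del: times_divide_eq_left)
  also have "\<dots> \<le> 1 / T\<^sup>2 * (4 * T / \<omega> * L2_norm T e) + 2 / T * (4 * T * L2_norm T e) + (L2_norm T e + \<omega>\<^sup>2 * (4 * T / \<omega> * L2_norm T e))"
    using T by (intro add_mono mult_left_mono b) auto
  also have "\<dots> = (4 / (T * \<omega>) + 9 + 4 * T * \<omega>) * L2_norm T e"
    using T \<omega>(1) by (simp add: field_simps power2_eq_square)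
  finally have yb: "L2_norm T y \<le> (4 / (T * \<omega>) + 9 + 4 * T * \<omega>) * L2_norm T e" .
  have "L2_norm T z2 \<le> L2_norm T (\<lambda>t. exp 1 * y t)"
    using T by (intro L2_norm_mono z2 L2_cmult y) (auto simp: z2_def q_def abs_mult intro!: mult_right_mono)
  also have "\<dots> = exp 1 * L2_norm T y" by (simp add: L2_norm_cmult)
  also have "\<dots> \<le> exp 1 * ((4 / (T * \<omega>) + 9 + 4 * T * \<omega>) * L2_norm T e)"
    by (intro mult_left_mono yb) auto
  finally have z2b: "L2_norm T z2 \<le> dual_const T \<mu> * L2_norm T e"
    by (simp add: dual_const_def \<omega>_def mult.assoc)
  have dual: "bil T \<mu> V D g z = L2_inner T V e" if v: "h20_rep T v V D g" for v V D g
  proof -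
    note rv = h20_rep_props[OF T v]
    have wz: "(\<lambda>t. weight T t * z t) = \<zeta>"
      by (auto simp: weight_def z_def q_def exp_minus)
    have "L2_inner T g \<zeta> = - D 0 * \<zeta> 0 - (LINT t|leb T. D t * \<zeta>1 t)"
      unfolding L2_inner_def using ac_parts[OF rv(3) 1 T] end_values by simp
    also have "(LINT t|leb T. D t * \<zeta>1 t) = - L2_inner T V (\<lambda>t. e t - \<mu> * \<zeta> t)"
      unfolding L2_inner_def using ac_parts[OF rv(2) 2 T] end_values rv(5) \<omega>(2) by simp
    also have "L2_inner T V (\<lambda>t. e t - \<mu> * \<zeta> t) = L2_inner T V e - L2_inner T V (\<lambda>t. \<mu> * \<zeta> t)"
      by (rule L2_inner_diff_right[OF e L2_cmult[OF L(1)] ac_L2[OF rv(2)]])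
    also have "L2_inner T V (\<lambda>t. \<mu> * \<zeta> t) = \<mu> * L2_inner T V \<zeta>"
      by (simp add: L2_inner_def mult.left_commute)
    finally show ?thesis
      unfolding bil_def wz by (simp add: z_def q_def)
  qed
  show thesis using that[OF Z z1 z2 z2b dual] .
qed

lemma h20_rep_H3:
  assumes T: "0 < T" and rep: "h20_rep T w W D g" and g: "ac T g k" and k: "k \<in> L2 T"
  shows "w \<in> H_space T 3" and "AE t in leb T. wD T 3 w t = k t"
proof -
  note r = h20_rep_props[OF T rep]
  have "weak_deriv T 0 k k" using L2_integrable[OF k] by (intro weak_deriv_0 integrable_imp_L1_loc)
  then have "weak_deriv T 1 g k" using weak_deriv_Suc[OF _ g _ T, of g 0 k] by simp
  then have "weak_deriv T 2 D k" using weak_deriv_Suc[OF _ r(3) _ T, of D 1 k] by (simp add: numeral_2_eq_2)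
  then have w3: "weak_deriv T 3 w k" using weak_deriv_Suc[OF r(1,2) _ T, of 2 k] by (simp add: numeral_3_eq_3 numeral_2_eq_2)
  then show "AE t in leb T. wD T 3 w t = k t" by (rule AE_wD)
  have "w \<in> H_space T 2" using h20_rep_H20[OF T rep] by (simp add: H20_def)
  then show "w \<in> H_space T 3"
    using w3 k by (auto simp: H_space_def le_Suc_eq numeral_3_eq_3 numeral_2_eq_2)
qed

section \<open>The error estimate\<close>

lemma L2_norm_zero_AE:
  assumes f: "f \<in> L2 T" and z: "L2_norm T f \<le> 0"
  shows "AE t in leb T. f t = 0"
proof -
  have "(LINT t|leb T. (f t)\<^sup>2) = 0"
    using z L2_norm_nonneg[of T f] L2_norm_squared[of T f] by simp
  then have "AE t in leb T. (f t)\<^sup>2 = 0"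
    using f by (subst (asm) integral_nonneg_eq_0_iff_AE) (auto simp: L2_iff)
  then show ?thesis by eventually_elim simp
qed

lemma h20_rep_identity:
  assumes "0 < T" "AE t in leb T. w t = t"
  shows "h20_rep T w (\<lambda>t. t) (\<lambda>t. 1) (\<lambda>t. 0)"
proof -
  have "ac T (\<lambda>t. t) (\<lambda>t. 1)" by (rule ac_C1) (auto intro!: derivative_eq_intros)
  then show ?thesis using assms ac_const[of T 1] L2_const[of 0 T] by (simp add: h20_rep_def)
qed

lemma L2_norm_identity_le: "0 < T \<Longrightarrow> L2_norm T (\<lambda>t. t) \<le> T * sqrt T"
  using L2_norm_ac_le[OF _ h20_rep_props(2)[OF _ h20_rep_identity[of T "\<lambda>t. t"]] L2_const]
  by (simp add: L2_norm_const)

text \<open>A sum that dominates every coefficient in the interpolation estimates: \<open>1\<close>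
  and \<open>T\<^sup>2\<close> belong to \<open>s = 1\<close>, the multiples of
  \<open>C\<^sub>a\<close> to the second derivative, the initial slope and the function for
  \<open>s \<ge> 2\<close>.\<close>

definition interp_const where
  "interp_const T C\<^sub>I C\<^sub>a = 1 + T\<^sup>2 + C\<^sub>a * (1 + (C\<^sub>I * T + T) / sqrt T + (C\<^sub>I * T)\<^sup>2)"

definition energy_const where
  "energy_const T \<mu> C\<^sub>I C\<^sub>a = 2 * (2 + \<mu>) * interp_const T C\<^sub>I C\<^sub>a / min (exp (-1) / (2 * T)) (1 / 2)"

text \<open>The three summands in the bracket stem from the three terms of the form at the error and
  \<open>Z - Z_h\<close>: second derivative, initial slopes, zero-order part.\<close>

definition error_const where
  "error_const T \<mu> C\<^sub>I C\<^sub>a =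
     (let A = interp_const T C\<^sub>I C\<^sub>a; B = energy_const T \<mu> C\<^sub>I C\<^sub>a in
      dual_const T \<mu> * (C\<^sub>a * (C\<^sub>I * T * A + C\<^sub>I * B) + C\<^sub>a * ((C\<^sub>I * T + T) / sqrt T) * (A + B)
        + \<mu> * C\<^sub>a * (C\<^sub>I * T) * (A + T * B)))"

text \<open>One factor \<open>x + y\<close> is cancelled from a coercivity estimate; the 2 comes
  from \<open>(x + y)\<^sup>2 \<le> 2 (x\<^sup>2 + y\<^sup>2)\<close>.\<close>

lemma quadratic_bound:
  fixes x y K c :: real
  assumes c: "0 < c" and xy: "0 \<le> x" "0 \<le> y" and K: "0 \<le> K" and le: "c * (x\<^sup>2 + y\<^sup>2) \<le> K * (x + y)"
  shows "x + y \<le> 2 * K / c"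
proof (cases "x + y = 0")
  case False
  then have pos: "0 < x + y" using xy by linarith
  have "(x + y)\<^sup>2 \<le> 2 * (x\<^sup>2 + y\<^sup>2)"
    using zero_le_power2[of "x - y"] by (simp add: power2_eq_square algebra_simps)
  then have "c * (x + y)\<^sup>2 \<le> c * (2 * (x\<^sup>2 + y\<^sup>2))" using c by (intro mult_left_mono) auto
  also have "\<dots> \<le> 2 * K * (x + y)" using le by linarith
  finally have "(c * (x + y)) * (x + y) \<le> (2 * K) * (x + y)" by (simp add: power2_eq_square)
  then have "c * (x + y) \<le> 2 * K" using pos by (rule mult_right_le_imp_le)
  then show ?thesis using c by (simp add: field_simps)
qed (use K c in simp)

section \<open>Estimates in one discrete space, with constants that do not involve the mesh
  parameter\<close>

context
  fixes T \<mu> C\<^sub>I C\<^sub>a h :: real and p :: nat and V :: "(real \<Rightarrow> real) set"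
  assumes T: "0 < T" and \<mu>: "0 < \<mu>" and p: "2 \<le> p" and CI: "0 < C\<^sub>I" and Ca: "0 < C\<^sub>a"
    and h: "0 < h" and V: "finite_dim_subspace T V"
    and inv: "\<And>w. w \<in> V \<Longrightarrow> H20_norm T w \<le> C\<^sub>I * inverse h * L2_norm T (wD T 1 w)"
      "\<And>w. w \<in> V \<Longrightarrow> L2_norm T (wD T 1 w) \<le> C\<^sub>I * inverse h * L2_norm T w"
    and approx: "\<And>s w. s \<le> p \<Longrightarrow> w \<in> H20 T \<Longrightarrow> w \<in> H_space T (s + 1) \<Longrightarrow>
      \<exists>w'\<in>V. \<forall>l\<in>{0,1,2}. l \<le> s \<longrightarrow>
        L2_norm T (\<lambda>t. wD T l w t - wD T l w' t) \<le> C\<^sub>a * h ^ (s + 1 - l) * L2_norm T (wD T (s + 1) w)"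
begin

lemma V_H20: "w \<in> V \<Longrightarrow> w \<in> H20 T"
  and V_add: "v \<in> V \<Longrightarrow> w \<in> V \<Longrightarrow> (\<lambda>t. v t + w t) \<in> V"
  and V_cmult: "w \<in> V \<Longrightarrow> (\<lambda>t. c * w t) \<in> V"
proof -
  have *: "V \<subseteq> H20 T" "\<forall>v\<in>V. \<forall>w\<in>V. (\<lambda>t. v t + w t) \<in> V" "\<forall>c. \<forall>v\<in>V. (\<lambda>t. c * v t) \<in> V"
    using V unfolding finite_dim_subspace_def by simp_all
  show "w \<in> V \<Longrightarrow> w \<in> H20 T" using *(1) by (rule subsetD)
  show "v \<in> V \<Longrightarrow> w \<in> V \<Longrightarrow> (\<lambda>t. v t + w t) \<in> V" by (rule *(2)[rule_format])
  show "w \<in> V \<Longrightarrow> (\<lambda>t. c * w t) \<in> V" by (rule *(3)[rule_format])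
qed

lemma V_diff: "v \<in> V \<Longrightarrow> w \<in> V \<Longrightarrow> (\<lambda>t. v t - w t) \<in> V"
  using V_add[of v "\<lambda>t. (-1) * w t"] V_cmult[of w "-1"] by simp

text \<open>Transfers the approximation property from chosen weak derivatives to representatives.
  The guard \<open>2 \<le> s\<close> reflects that only derivatives of order at most
  \<open>s\<close> are controlled.\<close>

lemma approx_rep:
  assumes s: "1 \<le> s" "s \<le> p" and w: "h20_rep T w W D g" "w \<in> H_space T (s + 1)"
  obtains w' W' D' g' where "w' \<in> V" "h20_rep T w' W' D' g'"
    "L2_norm T (\<lambda>t. W t - W' t) \<le> C\<^sub>a * h ^ (s + 1) * L2_norm T (wD T (s + 1) w)"
    "L2_norm T (\<lambda>t. D t - D' t) \<le> C\<^sub>a * h ^ s * L2_norm T (wD T (s + 1) w)"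
    "2 \<le> s \<longrightarrow> L2_norm T (\<lambda>t. g t - g' t) \<le> C\<^sub>a * h ^ (s - 1) * L2_norm T (wD T (s + 1) w)"
proof -
  from approx[OF s(2) h20_rep_H20[OF T w(1)] w(2)]
  obtain w' where w': "w' \<in> V" and a: "\<And>l. l \<in> {0,1,2} \<Longrightarrow> l \<le> s \<Longrightarrow>
        L2_norm T (\<lambda>t. wD T l w t - wD T l w' t) \<le> C\<^sub>a * h ^ (s + 1 - l) * L2_norm T (wD T (s + 1) w)" by blast
  obtain W' D' g' where r': "h20_rep T w' W' D' g'"
    using H20_obtains_rep[OF T V_H20[OF w']] by blast
  note e = h20_rep_wD[OF T w(1)] and e' = h20_rep_wD[OF T r']
  have "AE t in leb T. wD T 0 w t - wD T 0 w' t = W t - W' t"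
    using e(1) e'(1) by eventually_elim simp
  from a[of 0] L2_norm_AE[OF this] have 0: "L2_norm T (\<lambda>t. W t - W' t) \<le> C\<^sub>a * h ^ (s + 1) * L2_norm T (wD T (s + 1) w)"
    by simp
  have "AE t in leb T. wD T 1 w t - wD T 1 w' t = D t - D' t"
    using e(2) e'(2) by eventually_elim simp
  from a[of 1] L2_norm_AE[OF this] s(1) have 1: "L2_norm T (\<lambda>t. D t - D' t) \<le> C\<^sub>a * h ^ s * L2_norm T (wD T (s + 1) w)"
    by simp
  have "AE t in leb T. wD T 2 w t - wD T 2 w' t = g t - g' t"
    using e(3) e'(3) by eventually_elim simp
  from a[of 2] L2_norm_AE[OF this] have 2: "2 \<le> s \<longrightarrow> L2_norm T (\<lambda>t. g t - g' t) \<le> C\<^sub>a * h ^ (s - 1) * L2_norm T (wD T (s + 1) w)"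
    by (simp add: numeral_2_eq_2)
  show thesis by (rule that[OF w' r' 0 1 2])
qed

text \<open>The approximation property with \<open>s = 1\<close> reproduces \<open>t\<close> exactly, because its second derivative vanishes.\<close>

lemma identity_in_V:
  obtains \<tau> where "\<tau> \<in> V" "h20_rep T \<tau> (\<lambda>t. t) (\<lambda>t. 1) (\<lambda>t. 0)"
proof -
  have r: "h20_rep T (\<lambda>t. t) (\<lambda>t. t) (\<lambda>t. 1) (\<lambda>t. 0)" by (rule h20_rep_identity[OF T]) simp
  have "(\<lambda>t. t) \<in> H_space T (1 + 1)"
    using h20_rep_H20[OF T r] by (simp add: H20_def numeral_2_eq_2)
  from approx_rep[OF _ _ r this] p obtain w' W' D' g' where w': "w' \<in> V" "h20_rep T w' W' D' g'"
    "L2_norm T (\<lambda>t. t - W' t) \<le> C\<^sub>a * h ^ (1 + 1) * L2_norm T (wD T (1 + 1) (\<lambda>t. t))"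
    by (metis one_le_numeral order_refl order_trans)
  have "L2_norm T (wD T 2 (\<lambda>t. t)) = 0"
    using L2_norm_AE[OF h20_rep_wD(3)[OF T r]] by (simp add: L2_norm_def)
  then have "L2_norm T (\<lambda>t. t - W' t) \<le> 0" using w'(3) by (simp add: numeral_2_eq_2)
  then have "AE t in leb T. t - W' t = 0"
    using L2_diff[OF ac_L2[OF h20_rep_props(2)[OF T r]] ac_L2[OF h20_rep_props(2)[OF T w'(2)]]]
    by (intro L2_norm_zero_AE)
  then have "AE t in leb T. w' t = t"
    using h20_rep_props(1)[OF T w'(2)] by eventually_elim simp
  then show thesis using that[OF w'(1)] h20_rep_identity[OF T] by blast
qed

text \<open>The inverse inequality for the function t, whose derivative has norm
  \<open>sqrt T\<close> while its own norm is at most \<open>T * sqrt T\<close>.\<close>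

lemma h_le: "h \<le> C\<^sub>I * T"
proof -
  obtain \<tau> where \<tau>: "\<tau> \<in> V" and r: "h20_rep T \<tau> (\<lambda>t. t) (\<lambda>t. 1) (\<lambda>t. 0)" by (rule identity_in_V)
  have "sqrt T = L2_norm T (wD T 1 \<tau>)"
    using L2_norm_AE[OF h20_rep_wD(2)[OF T r]] T by (simp add: L2_norm_const)
  also have "\<dots> \<le> C\<^sub>I * inverse h * L2_norm T \<tau>" by (rule inv(2)[OF \<tau>])
  also have "L2_norm T \<tau> = L2_norm T (\<lambda>t. t)" by (rule L2_norm_AE[OF h20_rep_props(1)[OF T r]])
  also have "C\<^sub>I * inverse h * \<dots> \<le> C\<^sub>I * inverse h * (T * sqrt T)"
    using CI h by (intro mult_left_mono L2_norm_identity_le T) auto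
  also have "\<dots> = (C\<^sub>I * T / h) * sqrt T" by (simp add: field_simps)
  finally have "1 * sqrt T \<le> (C\<^sub>I * T / h) * sqrt T" by simp
  then have "1 \<le> C\<^sub>I * T / h" by (rule mult_right_le_imp_le) (use T in simp)
  then show ?thesis using h by (simp add: field_simps)
qed

lemma inverse_rep:
  assumes w: "w \<in> V" and r: "h20_rep T w W D g"
  shows "h * L2_norm T g \<le> C\<^sub>I * L2_norm T D"
proof -
  have "L2_norm T g \<le> H20_norm T w"
    using L2_norm_AE[OF h20_rep_wD(3)[OF T r]] T L2_norm_nonneg by (simp add: H20_norm_def)
  also have "\<dots> \<le> C\<^sub>I * inverse h * L2_norm T (wD T 1 w)" by (rule inv(1)[OF w])
  also have "L2_norm T (wD T 1 w) = L2_norm T D" by (rule L2_norm_AE[OF h20_rep_wD(2)[OF T r]])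
  finally show ?thesis using h by (simp add: field_simps)
qed

text \<open>For \<open>s = 1\<close> the choice \<open>D 0 * t\<close> has the right initial slope
  and no second derivative, and two Poincare inequalities bound the rest. For
  \<open>s \<ge> 2\<close> the initial slope follows from the trace inequality, limited by the order
  of the second derivative.\<close>

lemma interpolation:
  assumes s: "1 \<le> s" "s \<le> p" and u: "h20_rep T u U D g" "u \<in> H_space T (s + 1)"
  obtains w W E k where "w \<in> V" "h20_rep T w W E k"
    "L2_norm T (\<lambda>t. g t - k t) \<le> interp_const T C\<^sub>I C\<^sub>a * (h ^ (s - 1) * L2_norm T (wD T (s + 1) u))"
    "\<bar>D 0 - E 0\<bar> \<le> interp_const T C\<^sub>I C\<^sub>a * (h ^ (s - 1) * L2_norm T (wD T (s + 1) u))"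
    "L2_norm T (\<lambda>t. U t - W t) \<le> interp_const T C\<^sub>I C\<^sub>a * (h ^ (s - 1) * L2_norm T (wD T (s + 1) u))"
proof -
  define P where "P = h ^ (s - 1) * L2_norm T (wD T (s + 1) u)"
  have P0: "0 \<le> P" using h by (simp add: P_def L2_norm_nonneg)
  have c: "0 \<le> T\<^sup>2" "0 \<le> C\<^sub>a" "0 \<le> C\<^sub>a * ((C\<^sub>I * T + T) / sqrt T)" "0 \<le> C\<^sub>a * (C\<^sub>I * T)\<^sup>2"
    using Ca CI T by auto
  have ic: "interp_const T C\<^sub>I C\<^sub>a = 1 + T\<^sup>2 + C\<^sub>a + C\<^sub>a * ((C\<^sub>I * T + T) / sqrt T) + C\<^sub>a * (C\<^sub>I * T)\<^sup>2"
    unfolding interp_const_def by (simp add: distrib_left)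
  have le: "x \<le> interp_const T C\<^sub>I C\<^sub>a * P" if "x \<le> y * P" "y \<le> interp_const T C\<^sub>I C\<^sub>a" for x y
    using that mult_right_mono[OF that(2) P0] by linarith
  note ru = h20_rep_props[OF T u(1)]
  show thesis
  proof (cases "s = 1")
    case True
    obtain \<tau> where \<tau>: "\<tau> \<in> V" and r: "h20_rep T \<tau> (\<lambda>t. t) (\<lambda>t. 1) (\<lambda>t. 0)" by (rule identity_in_V)
    have rc: "h20_rep T (\<lambda>t. D 0 * \<tau> t) (\<lambda>t. D 0 * t) (\<lambda>t. D 0) (\<lambda>t. 0)"
      using h20_rep_cmult[OF r, of "D 0"] by simp
    note rd = h20_rep_props[OF T h20_rep_diff[OF u(1) rc]]
    \<comment> \<open>With \<open>s = 1\<close> the power of \<open>h\<close> is 1, and the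
      derivative of order \<open>s + 1\<close> is \<open>g\<close>.\<close>
    have P: "P = L2_norm T g"
      using True L2_norm_AE[OF h20_rep_wD(3)[OF T u(1)]] by (simp add: P_def numeral_2_eq_2)
    have "L2_norm T (\<lambda>t. U t - D 0 * t) \<le> T * L2_norm T (\<lambda>t. D t - D 0)"
      using L2_norm_ac_le[OF T rd(2) ac_L2[OF rd(3)] rd(5)] .
    also have "\<dots> \<le> T * (T * L2_norm T g)"
      using L2_norm_ac_le[OF T rd(3,4)] T by simp
    also have "\<dots> = T\<^sup>2 * P" by (simp add: P power2_eq_square)
    finally have U: "L2_norm T (\<lambda>t. U t - D 0 * t) \<le> T\<^sup>2 * P" .
    show thesis
    proof (rule that[OF V_cmult[OF \<tau>] rc, folded P_def])
      show "L2_norm T (\<lambda>t. g t - 0) \<le> interp_const T C\<^sub>I C\<^sub>a * P"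
        by (rule le[of _ 1]) (use c in \<open>auto simp: P ic\<close>)
      show "L2_norm T (\<lambda>t. U t - D 0 * t) \<le> interp_const T C\<^sub>I C\<^sub>a * P"
        by (rule le[OF U]) (use c in \<open>auto simp: ic\<close>)
      show "\<bar>D 0 - D 0\<bar> \<le> interp_const T C\<^sub>I C\<^sub>a * P"
        by (rule le[of _ 0]) (use c in \<open>auto simp: ic\<close>)
    qed
  next
    case False
    with s have s2: "2 \<le> s" by simp
    obtain w W E k where w: "w \<in> V" "h20_rep T w W E k"
      and a: "L2_norm T (\<lambda>t. U t - W t) \<le> C\<^sub>a * h ^ (s + 1) * L2_norm T (wD T (s + 1) u)"
        "L2_norm T (\<lambda>t. D t - E t) \<le> C\<^sub>a * h ^ s * L2_norm T (wD T (s + 1) u)"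
        "2 \<le> s \<longrightarrow> L2_norm T (\<lambda>t. g t - k t) \<le> C\<^sub>a * h ^ (s - 1) * L2_norm T (wD T (s + 1) u)"
      by (rule approx_rep[OF s u])
    note rd = h20_rep_props[OF T h20_rep_diff[OF u(1) w(2)]]
    have hs: "h ^ s = h * h ^ (s - 1)" using s(1) by (cases s) auto
    have hP: "h * P \<le> C\<^sub>I * T * P" using h_le P0 by (rule mult_right_mono)
    have "L2_norm T (\<lambda>t. U t - W t) \<le> C\<^sub>a * (h\<^sup>2 * P)"
      using a(1) by (simp add: P_def hs power2_eq_square mult_ac)
    also have "\<dots> \<le> C\<^sub>a * ((C\<^sub>I * T)\<^sup>2 * P)"
      using h h_le Ca P0 by (intro mult_left_mono mult_right_mono power_mono) auto
    finally have U: "L2_norm T (\<lambda>t. U t - W t) \<le> (C\<^sub>a * (C\<^sub>I * T)\<^sup>2) * P" by simp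
    have D: "L2_norm T (\<lambda>t. D t - E t) \<le> C\<^sub>a * (h * P)"
      using a(2) by (simp add: P_def hs mult_ac)
    have G: "L2_norm T (\<lambda>t. g t - k t) \<le> C\<^sub>a * P"
      using a(3) s2 by (simp add: P_def mult_ac)
    have "\<bar>D 0 - E 0\<bar> \<le> (L2_norm T (\<lambda>t. D t - E t) + T * L2_norm T (\<lambda>t. g t - k t)) / sqrt T"
      by (rule ac_initial_value_le[OF T rd(3,4)])
    also have "\<dots> \<le> (C\<^sub>a * (C\<^sub>I * T * P) + T * (C\<^sub>a * P)) / sqrt T"
    proof (intro divide_right_mono add_mono mult_left_mono G)
      have "C\<^sub>a * (h * P) \<le> C\<^sub>a * (C\<^sub>I * T * P)" using Ca by (intro mult_left_mono hP) auto
      then show "L2_norm T (\<lambda>t. D t - E t) \<le> C\<^sub>a * (C\<^sub>I * T * P)" using D by linarith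
    qed (use T in auto)
    also have "\<dots> = (C\<^sub>a * ((C\<^sub>I * T + T) / sqrt T)) * P"
      by (simp add: field_simps)
    finally have I: "\<bar>D 0 - E 0\<bar> \<le> (C\<^sub>a * ((C\<^sub>I * T + T) / sqrt T)) * P" .
    show thesis
    proof (rule that[OF w, folded P_def])
      show "L2_norm T (\<lambda>t. g t - k t) \<le> interp_const T C\<^sub>I C\<^sub>a * P"
        by (rule le[OF G]) (use c in \<open>auto simp: ic\<close>)
      show "\<bar>D 0 - E 0\<bar> \<le> interp_const T C\<^sub>I C\<^sub>a * P"
        by (rule le[OF I]) (use c in \<open>auto simp: ic\<close>)
      show "L2_norm T (\<lambda>t. U t - W t) \<le> interp_const T C\<^sub>I C\<^sub>a * P"
        by (rule le[OF U]) (use c in \<open>auto simp: ic\<close>)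
    qed
  qed
qed

text \<open>The data \<open>f\<close> are eliminated: \<open>orth\<close>, the Galerkin
  orthogonality on representatives, is all that the two variational problems contribute.\<close>

lemma galerkin_error:
  assumes s: "1 \<le> s" "s \<le> p" and u: "h20_rep T u U D g" "u \<in> H_space T (s + 1)"
    and v: "v \<in> V" "h20_rep T v X Y k"
    and orth: "\<And>w W E m. w \<in> V \<Longrightarrow> h20_rep T w W E m \<Longrightarrow> bil T \<mu> U D g E = bil T \<mu> X Y k E"
  shows "L2_norm T (\<lambda>t. U t - X t) \<le> error_const T \<mu> C\<^sub>I C\<^sub>a * h ^ s * L2_norm T (wD T (s + 1) u)"
proof -
  define P where "P = h ^ (s - 1) * L2_norm T (wD T (s + 1) u)"
  have P0: "0 \<le> P" using h by (simp add: P_def L2_norm_nonneg)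
  define A where "A = interp_const T C\<^sub>I C\<^sub>a"
  define B where "B = energy_const T \<mu> C\<^sub>I C\<^sub>a"
  define c where "c = min (exp (-1) / (2 * T)) (1 / 2)"
  have c: "0 < c" using T by (simp add: c_def)
  have A0: "0 \<le> A" using T CI Ca by (simp add: A_def interp_const_def)
  have B_eq: "B = 2 * ((2 + \<mu>) * A) / c" by (simp add: B_def energy_const_def A_def c_def)
  obtain i W E m where i: "i \<in> V" "h20_rep T i W E m"
    and I: "L2_norm T (\<lambda>t. g t - m t) \<le> A * P" "\<bar>D 0 - E 0\<bar> \<le> A * P" "L2_norm T (\<lambda>t. U t - W t) \<le> A * P"
    unfolding A_def P_def by (rule interpolation[OF s u])
  note \<eta> = h20_rep_diff[OF u(1) i(2)] and \<theta> = h20_rep_diff[OF i(2) v(2)] and e = h20_rep_diff[OF u(1) v(2)]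
  note r\<eta> = h20_rep_props[OF T \<eta>] and r\<theta> = h20_rep_props[OF T \<theta>] and re = h20_rep_props[OF T e]
  have \<theta>V: "(\<lambda>t. i t - v t) \<in> V" using V_diff[OF i(1) v(1)] .
  define x where "x = L2_norm T (\<lambda>t. E t - Y t)"
  define y where "y = \<bar>E 0 - Y 0\<bar>"
  have xy: "0 \<le> x" "0 \<le> y" by (auto simp: x_def y_def L2_norm_nonneg)
  let ?F = "\<lambda>t. E t - Y t"
  have F: "?F \<in> L2 T" using ac_L2[OF r\<theta>(3)] .
  \<comment> \<open>Coercivity is applied to the discrete part \<open>\<theta>\<close> of the error,
    since \<open>?F\<close> must be the derivative of an element of \<open>V\<close> for
    orthogonality.\<close>
  have "c * (x\<^sup>2 + y\<^sup>2) \<le> exp (-1) / (2 * T) * x\<^sup>2 + 1 / 2 * y\<^sup>2"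
    unfolding distrib_left by (intro add_mono mult_right_mono) (auto simp: c_def)
  also have "\<dots> = exp (-1) / (2 * T) * (L2_norm T ?F)\<^sup>2 + (?F 0)\<^sup>2 / 2"
    by (simp add: x_def y_def)
  also have "\<dots> \<le> bil T \<mu> (\<lambda>t. W t - X t) ?F (\<lambda>t. m t - k t) ?F"
    using bil_coercive[OF T _ \<theta>, of \<mu>] \<mu> by simp
  also have "\<dots> = bil T \<mu> W E m ?F - bil T \<mu> X Y k ?F" by (rule bil_diff_left[OF T F i(2) v(2)])
  \<comment> \<open>Exchanging the discrete for the exact solution leaves only the interpolation
    error in the first argument.\<close>
  also have "bil T \<mu> X Y k ?F = bil T \<mu> U D g ?F" using orth[OF \<theta>V \<theta>] by simp
  also have "bil T \<mu> W E m ?F - bil T \<mu> U D g ?F = - bil T \<mu> (\<lambda>t. U t - W t) (\<lambda>t. D t - E t) (\<lambda>t. g t - m t) ?F"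
    using bil_diff_left[OF T F u(1) i(2), of \<mu>] by simp
  also have "\<dots> \<le> \<bar>bil T \<mu> (\<lambda>t. U t - W t) (\<lambda>t. D t - E t) (\<lambda>t. g t - m t) ?F\<bar>" by simp
  also have "\<dots> \<le> L2_norm T (\<lambda>t. g t - m t) * x + \<bar>D 0 - E 0\<bar> * y + \<mu> * (L2_norm T (\<lambda>t. U t - W t) * x)"
    using bil_bound[OF T _ F \<eta>, of \<mu>] \<mu> by (simp add: x_def y_def)
  also have "\<dots> \<le> (A * P) * x + (A * P) * y + \<mu> * ((A * P) * x)"
    using \<mu> xy by (intro add_mono mult_left_mono mult_right_mono I) auto
  also have "\<dots> \<le> ((2 + \<mu>) * A * P) * (x + y)"
  proof -
    have "0 \<le> A * P * x" "0 \<le> A * P * y" "0 \<le> \<mu> * (A * P * y)" using \<mu> A0 P0 xy by auto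
    moreover have "((2 + \<mu>) * A * P) * (x + y)
        = 2 * (A * P * x) + 2 * (A * P * y) + \<mu> * (A * P * x) + \<mu> * (A * P * y)"
      by (simp add: algebra_simps)
    ultimately show ?thesis by linarith
  qed
  finally have "x + y \<le> 2 * ((2 + \<mu>) * A * P) / c"
    using c xy A0 P0 \<mu> by (intro quadratic_bound) auto
  also have "\<dots> = B * P" by (simp add: B_eq)
  finally have xB: "x \<le> B * P" and yB: "y \<le> B * P" using xy by auto

  \<comment> \<open>The inverse inequality is available for \<open>\<theta>\<close> but not for the
    error itself; keeping \<open>h\<close> on the left avoids negative powers when
    \<open>s = 1\<close>.\<close>
  have g\<theta>: "h * L2_norm T (\<lambda>t. m t - k t) \<le> C\<^sub>I * (B * P)"
    using inverse_rep[OF \<theta>V \<theta>] mult_left_mono[OF xB less_imp_le[OF CI]] unfolding x_def by linarith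
  have hP: "h * z \<le> C\<^sub>I * T * z" if "0 \<le> z" for z using h_le that by (rule mult_right_mono)
  have "L2_norm T (\<lambda>t. g t - k t) = L2_norm T (\<lambda>t. (g t - m t) + (m t - k t))" by simp
  also have "\<dots> \<le> L2_norm T (\<lambda>t. g t - m t) + L2_norm T (\<lambda>t. m t - k t)"
    by (rule L2_norm_triangle[OF r\<eta>(4) r\<theta>(4)])
  finally have "h * L2_norm T (\<lambda>t. g t - k t) \<le> h * L2_norm T (\<lambda>t. g t - m t) + h * L2_norm T (\<lambda>t. m t - k t)"
    using h by (simp flip: distrib_left)
  also have "\<dots> \<le> C\<^sub>I * T * (A * P) + C\<^sub>I * (B * P)"
    using mult_left_mono[OF I(1) less_imp_le[OF h]] hP[OF mult_nonneg_nonneg[OF A0 P0]] g\<theta> by linarith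
  finally have ge: "h * L2_norm T (\<lambda>t. g t - k t) \<le> (C\<^sub>I * T * A + C\<^sub>I * B) * P"
    by (simp add: algebra_simps)
  have "\<bar>D 0 - Y 0\<bar> \<le> \<bar>D 0 - E 0\<bar> + \<bar>E 0 - Y 0\<bar>" by simp
  also have "\<dots> \<le> (A + B) * P" using I(2) yB by (simp add: y_def distrib_right)
  finally have de: "\<bar>D 0 - Y 0\<bar> \<le> (A + B) * P" .
  have "L2_norm T (\<lambda>t. U t - X t) = L2_norm T (\<lambda>t. (U t - W t) + (W t - X t))" by simp
  also have "\<dots> \<le> L2_norm T (\<lambda>t. U t - W t) + L2_norm T (\<lambda>t. W t - X t)"
    by (rule L2_norm_triangle[OF ac_L2[OF r\<eta>(2)] ac_L2[OF r\<theta>(2)]])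
  also have "\<dots> \<le> A * P + T * (B * P)"
    using L2_norm_ac_le[OF T r\<theta>(2) F r\<theta>(5)] mult_left_mono[OF xB less_imp_le[OF T]] I(3)
    unfolding x_def by linarith
  finally have ve: "L2_norm T (\<lambda>t. U t - X t) \<le> (A + T * B) * P" by (simp add: algebra_simps)

  let ?e = "\<lambda>t. U t - X t"
  have eL: "?e \<in> L2 T" using ac_L2[OF re(2)] .
  obtain Z z z1 z2 where Z: "h20_rep T Z Z z z1" "ac T z1 z2" "z2 \<in> L2 T"
    and Q: "L2_norm T z2 \<le> dual_const T \<mu> * L2_norm T ?e"
    and dual: "\<And>v V D g. h20_rep T v V D g \<Longrightarrow> bil T \<mu> V D g z = L2_inner T V ?e"
    using dual_problem[OF T \<mu> eL] by blast
  define q where "q = L2_norm T z2"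
  have q0: "0 \<le> q" by (simp add: q_def L2_norm_nonneg)
  have H3: "Z \<in> H_space T (2 + 1)" "L2_norm T (wD T (2 + 1) Z) = q"
    using h20_rep_H3[OF T Z] L2_norm_AE by (auto simp: q_def)
  \<comment> \<open>Approximation with \<open>s = 2\<close>: order \<open>h\<^sup>2\<close> for the
    first derivative, order \<open>h\<close> for the second.\<close>
  obtain w' W' E' m' where w': "w' \<in> V" "h20_rep T w' W' E' m'"
    and a: "L2_norm T (\<lambda>t. z t - E' t) \<le> C\<^sub>a * h ^ 2 * q"
      "2 \<le> (2::nat) \<longrightarrow> L2_norm T (\<lambda>t. z1 t - m' t) \<le> C\<^sub>a * h ^ (2 - 1) * q"
    by (rule approx_rep[OF one_le_numeral p Z(1) H3(1), unfolded H3(2)])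
  note rr = h20_rep_props[OF T h20_rep_diff[OF Z(1) w'(2)]]
  let ?r = "\<lambda>t. z t - E' t"
  have rL: "?r \<in> L2 T" using ac_L2[OF rr(3)] .
  have r1: "L2_norm T ?r \<le> C\<^sub>a * h * (h * q)" using a(1) by (simp add: power2_eq_square mult_ac)
  have r2: "L2_norm T (\<lambda>t. z1 t - m' t) \<le> C\<^sub>a * (h * q)" using a(2) by (simp add: mult_ac)
  have hq: "0 \<le> h * q" using h q0 by simp
  have "\<bar>?r 0\<bar> \<le> (L2_norm T ?r + T * L2_norm T (\<lambda>t. z1 t - m' t)) / sqrt T"
    by (rule ac_initial_value_le[OF T rr(3,4)])
  also have "\<dots> \<le> (C\<^sub>a * (C\<^sub>I * T) * (h * q) + T * (C\<^sub>a * (h * q))) / sqrt T"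
  proof (intro divide_right_mono add_mono mult_left_mono r2)
    have "C\<^sub>a * h * (h * q) \<le> C\<^sub>a * (C\<^sub>I * T) * (h * q)"
      using h_le hq Ca by (intro mult_right_mono mult_left_mono) auto
    then show "L2_norm T ?r \<le> C\<^sub>a * (C\<^sub>I * T) * (h * q)" using r1 by linarith
  qed (use T in auto)
  also have "\<dots> = C\<^sub>a * ((C\<^sub>I * T + T) / sqrt T) * (h * q)" by (simp add: field_simps)
  finally have r0: "\<bar>?r 0\<bar> \<le> C\<^sub>a * ((C\<^sub>I * T + T) / sqrt T) * (h * q)" .

  define K where "K = C\<^sub>a * (C\<^sub>I * T * A + C\<^sub>I * B) + C\<^sub>a * ((C\<^sub>I * T + T) / sqrt T) * (A + B)
    + \<mu> * C\<^sub>a * (C\<^sub>I * T) * (A + T * B)"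
  have "(L2_norm T ?e)\<^sup>2 = L2_inner T ?e ?e"
    unfolding L2_norm_squared unfolding L2_inner_def power2_eq_square ..
  also have "\<dots> = bil T \<mu> ?e (\<lambda>t. D t - Y t) (\<lambda>t. g t - k t) z" using dual[OF e] by simp
  also have "\<dots> = bil T \<mu> ?e (\<lambda>t. D t - Y t) (\<lambda>t. g t - k t) ?r"
  proof -
    note w'L = ac_L2[OF h20_rep_props(3)[OF T w'(2)]] and zL = ac_L2[OF h20_rep_props(3)[OF T Z(1)]]
    have "bil T \<mu> ?e (\<lambda>t. D t - Y t) (\<lambda>t. g t - k t) E' = 0"
      using bil_diff_left[OF T w'L u(1) v(2), of \<mu>] orth[OF w'] by simp
    then show ?thesis using bil_diff_right[OF T zL w'L e, of \<mu>] by simp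
  qed
  also have "\<dots> \<le> L2_norm T (\<lambda>t. g t - k t) * L2_norm T ?r + \<bar>D 0 - Y 0\<bar> * \<bar>?r 0\<bar>
      + \<mu> * (L2_norm T ?e * L2_norm T ?r)"
    using bil_bound[OF T _ rL e, of \<mu>] \<mu> by simp
  also have "\<dots> \<le> C\<^sub>a * ((C\<^sub>I * T * A + C\<^sub>I * B) * P) * (h * q)
      + ((A + B) * P) * (C\<^sub>a * ((C\<^sub>I * T + T) / sqrt T) * (h * q))
      + \<mu> * (((A + T * B) * P) * (C\<^sub>a * (C\<^sub>I * T) * (h * q)))"
  proof (intro add_mono)
    \<comment> \<open>Of the two factors \<open>h\<close> in the bound for \<open>?r\<close>, one is
      spent on the second derivative of the error, which is only controlled after multiplication by
      \<open>h\<close>.\<close>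
    have "L2_norm T (\<lambda>t. g t - k t) * L2_norm T ?r \<le> L2_norm T (\<lambda>t. g t - k t) * (C\<^sub>a * h * (h * q))"
      by (intro mult_left_mono r1 L2_norm_nonneg)
    also have "\<dots> = C\<^sub>a * (h * L2_norm T (\<lambda>t. g t - k t)) * (h * q)" by (simp add: mult_ac)
    also have "\<dots> \<le> C\<^sub>a * ((C\<^sub>I * T * A + C\<^sub>I * B) * P) * (h * q)"
      using Ca hq by (intro mult_right_mono mult_left_mono ge) auto
    finally show "L2_norm T (\<lambda>t. g t - k t) * L2_norm T ?r \<le> C\<^sub>a * ((C\<^sub>I * T * A + C\<^sub>I * B) * P) * (h * q)" .
    show "\<bar>D 0 - Y 0\<bar> * \<bar>?r 0\<bar> \<le> ((A + B) * P) * (C\<^sub>a * ((C\<^sub>I * T + T) / sqrt T) * (h * q))"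
      using de by (intro mult_mono r0) auto
    have "C\<^sub>a * h * (h * q) \<le> C\<^sub>a * (C\<^sub>I * T) * (h * q)"
      using h_le hq Ca by (intro mult_right_mono mult_left_mono) auto
    then have "L2_norm T ?r \<le> C\<^sub>a * (C\<^sub>I * T) * (h * q)" using r1 by linarith
    then show "\<mu> * (L2_norm T ?e * L2_norm T ?r) \<le> \<mu> * (((A + T * B) * P) * (C\<^sub>a * (C\<^sub>I * T) * (h * q)))"
      using \<mu> order_trans[OF L2_norm_nonneg ve]
      by (intro mult_left_mono mult_mono ve) (auto simp: L2_norm_nonneg)
  qed
  also have "\<dots> = K * P * h * q" by (simp add: K_def algebra_simps)
  finally have fin: "(L2_norm T ?e)\<^sup>2 \<le> K * P * h * q" .
  have B0: "0 \<le> B" using c A0 \<mu> by (simp add: B_eq)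
  have K0: "0 \<le> K"
    unfolding K_def using A0 B0 CI Ca T \<mu> by (intro add_nonneg_nonneg mult_nonneg_nonneg divide_nonneg_nonneg) auto
  have "K * P * h * q \<le> K * P * h * (dual_const T \<mu> * L2_norm T ?e)"
    using K0 P0 h Q unfolding q_def by (intro mult_left_mono) auto
  with fin have "L2_norm T ?e * L2_norm T ?e \<le> (dual_const T \<mu> * K * (h * P)) * L2_norm T ?e"
    by (simp add: power2_eq_square mult_ac)
  moreover have "0 \<le> dual_const T \<mu> * K * (h * P)"
    using K0 P0 h T \<mu> by (simp add: dual_const_def)
  \<comment> \<open>One factor \<open>L2_norm T ?e\<close> is cancelled; if it is zero, the bound
    holds because its right-hand side is nonnegative.\<close>
  ultimately have "L2_norm T ?e \<le> dual_const T \<mu> * K * (h * P)"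
    using L2_norm_nonneg[of T ?e] by (cases "L2_norm T ?e = 0") (auto dest: mult_right_le_imp_le)
  also have "h * P = h ^ s * L2_norm T (wD T (s + 1) u)"
    using s(1) by (cases s) (auto simp: P_def)
  also have "dual_const T \<mu> * K = error_const T \<mu> C\<^sub>I C\<^sub>a"
    by (simp add: error_const_def K_def A_def B_def Let_def)
  finally show ?thesis by (simp add: mult.assoc)
qed

end

theorem corollary3p8:
  fixes T \<mu> C\<^sub>I C\<^sub>a :: real and p :: nat
  assumes "0 < T" and "0 < \<mu>" and "2 \<le> p" and "0 < C\<^sub>I" and "0 < C\<^sub>a"
  shows "\<exists>C\<^sub>\<mu>>0. \<forall>(\<H> :: real set) (S :: real \<Rightarrow> (real \<Rightarrow> real) set).
           discrete_spaces T \<H> S \<longrightarrow> assumption_A T p C\<^sub>I C\<^sub>a \<H> S \<longrightarrow>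
           (\<forall>h\<in>\<H>. \<forall>f\<in>L2 T. \<forall>u u\<^sub>h. \<forall>s::nat.
              continuous_solution T \<mu> f u \<longrightarrow>
              discrete_solution T \<mu> f (S h) u\<^sub>h \<longrightarrow>
              1 \<le> s \<longrightarrow> s \<le> p \<longrightarrow> u \<in> H20 T \<inter> H_space T (s + 1) \<longrightarrow>
              L2_norm T (\<lambda>t. u t - u\<^sub>h t) \<le> C\<^sub>\<mu> * h ^ s * L2_norm T (wD T (s + 1) u))"
proof (intro exI[of _ "max 1 (error_const T \<mu> C\<^sub>I C\<^sub>a)"] conjI allI impI ballI)
  note T = \<open>0 < T\<close>
  fix \<H> S h f u u\<^sub>h and s :: nat
  assume S: "discrete_spaces T \<H> S" and A: "assumption_A T p C\<^sub>I C\<^sub>a \<H> S" and h: "h \<in> \<H>"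
    and u: "continuous_solution T \<mu> f u" and uh: "discrete_solution T \<mu> f (S h) u\<^sub>h"
    and s: "1 \<le> s" "s \<le> p" and us: "u \<in> H20 T \<inter> H_space T (s + 1)"
  have hV: "0 < h" "finite_dim_subspace T (S h)" using S h by (auto simp: discrete_spaces_def)
  have inv: "H20_norm T w \<le> C\<^sub>I * inverse h * L2_norm T (wD T 1 w)"
      "L2_norm T (wD T 1 w) \<le> C\<^sub>I * inverse h * L2_norm T w" if "w \<in> S h" for w
    using A h that unfolding assumption_A_def inverse_inequalities_def by blast+
  have approx: "\<exists>w'\<in>S h. \<forall>l\<in>{0,1,2}. l \<le> s \<longrightarrow>
        L2_norm T (\<lambda>t. wD T l w t - wD T l w' t) \<le> C\<^sub>a * h ^ (s + 1 - l) * L2_norm T (wD T (s + 1) w)"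
    if "s \<le> p" "w \<in> H20 T" "w \<in> H_space T (s + 1)" for s w
    using A h that unfolding assumption_A_def approximation_property_def by blast
  have uhV: "u\<^sub>h \<in> S h" using uh by (simp add: discrete_solution_def)
  have S_H20: "w \<in> S h \<Longrightarrow> w \<in> H20 T" for w using hV(2) unfolding finite_dim_subspace_def by (elim conjE subsetD)
  obtain U D g where ru: "h20_rep T u U D g" using H20_obtains_rep[OF T] us by blast
  obtain X Y k where rv: "h20_rep T u\<^sub>h X Y k" using H20_obtains_rep[OF T S_H20[OF uhV]] by blast
  have orth: "bil T \<mu> U D g E = bil T \<mu> X Y k E" if w: "w \<in> S h" "h20_rep T w W E m" for w W E m
  proof -
    \<comment> \<open>The transformed function need not be discrete, but as an element of the trial
      space it may be inserted in the continuous problem, and the discrete problem is tested with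
      the same function.\<close>
    have "L_op T w \<in> H20 T" by (rule h20_rep_H20[OF T h20_rep_L_op[OF T w(2)]])
    then have "a_form T \<mu> u (L_op T w) = a_form T \<mu> u\<^sub>h (L_op T w)"
      using u uh w(1) by (simp add: continuous_solution_def discrete_solution_def)
    then show ?thesis using a_form_L_op[OF T ru w(2)] a_form_L_op[OF T rv w(2)] by simp
  qed
  have "L2_norm T (\<lambda>t. u t - u\<^sub>h t) = L2_norm T (\<lambda>t. U t - X t)"
    using h20_rep_props(1)[OF T h20_rep_diff[OF ru rv]] by (rule L2_norm_AE)
  also have "\<dots> \<le> error_const T \<mu> C\<^sub>I C\<^sub>a * h ^ s * L2_norm T (wD T (s + 1) u)"
    by (rule galerkin_error[OF T assms(2-5) hV inv approx s ru _ uhV rv orth]) (use us in auto)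
  \<comment> \<open>The maximum with 1 makes positivity of the constant immediate.\<close>
  also have "\<dots> \<le> max 1 (error_const T \<mu> C\<^sub>I C\<^sub>a) * h ^ s * L2_norm T (wD T (s + 1) u)"
    using hV(1) by (intro mult_right_mono L2_norm_nonneg) auto
  finally show "L2_norm T (\<lambda>t. u t - u\<^sub>h t) \<le> max 1 (error_const T \<mu> C\<^sub>I C\<^sub>a) * h ^ s * L2_norm T (wD T (s + 1) u)" .
qed simp

end
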